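(* Let $w\in S_n$ be a permutation almost defined by inclusions. Then there exists a permutation $v\in S_n$ such that (1) the essential set $E(v)=E(w)\setminus E''(w)$, and (2) $r_v(p,q)=r_w(p,q)$ for all $(p,q)\in E(v)$. These conditions define a unique permutation $v$, which is defined by inclusions. Furthermore, $\ell(v)-\ell(w)$ is the number of boxes in $E''(w)$.
   Context: Write $[a,b]=\{x\in\mathbb{Z}: a\le x\le b\}$; $\ell(w)$ is the number of inversions of $w$. Positions $(p,q)$ are matrix positions (row $p$ from the top, column $q$ from the left). For $w\in S_n$ set $r_w(p,q)=\#\{k\le q : w(k)\ge p\}$, $D(w)=\{(p,q)\in[1,n]^2 : w(q)<p,\ w^{-1}(p)>q\}$ and $E(w)=\{(p,q)\in D(w): (p,q+1)\notin D(w),\ (p-1,q)\notin D(w)\}$. Call $w$ defined by inclusions if $q-r_w(p,q)=\min\{p-1,q\}$ for every $(p,q)\in E(w)$. Conditions on $(p,q)\in E(w)$: A: there is no $k$ with $k\le q$ and $w(k)\ge p$. B: there is no $k$ with $k>q$ and $w(k)<p$. W: for all $p'<p$, $(p',q)\notin E(w)$; and either $(p,q-1)\notin D(w)$ or there exists $p'<p$ with $(p',q-1)\in E(w)$ satisfying Condition B and $r_w(p',q-1)=r_w(p,q)$. X: there is a unique $p'<p$ with $(p',q)\in E(w)$; $(p',q)$ satisfies Condition B and $r_w(p',q)=r_w(p,q)+1$; and, if $q'$ is the smallest integer with $(p',b)\in D(w)$ for all $b\in[q',q]$, then $(p,q'-1)\in D(w)$. Y: for all $q'>q$, $(p,q')\notin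 E(w)$; and either $(p+1,q)\notin D(w)$ or there exists $q'>q$ with $(p+1,q')\in E(w)$ satisfying Condition B and $r_w(p+1,q')=r_w(p,q)$. Z: there is a unique $q'>q$ with $(p,q')\in E(w)$; $(p,q')$ satisfies Condition B and $r_w(p,q')=r_w(p,q)+1$; and, if $p'$ is the greatest integer with $(a,q')\in D(w)$ for all $a\in[p,p']$, then $(p'+1,q)\in D(w)$. The permutation $w$ is almost defined by inclusions if every $(p,q)\in E(w)$ satisfies A or B, or satisfies both (W or X) and (Y or Z). $E''(w)$ is the set of $(p,q)\in E(w)$ satisfying neither A nor B. *)

theory Defs
  imports "HOL-Combinatorics.Permutations"
begin

text \<open>
  Elements of the symmetric group on \<open>n\<close> letters are functions \<open>w :: nat \<Rightarrow> nat\<close> with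
  \<open>w permutes {1..n}\<close> (hence the identity outside \<open>{1..n}\<close>), and matrix positions are pairs
  \<open>(p, q)\<close>, row \<open>p\<close> from the top and column \<open>q\<close> from the left.  Positions of interest have
  \<open>p, q \<ge> 1\<close>, so that truncated subtraction \<open>p - 1\<close>, \<open>q - 1\<close> agrees with subtraction
  of integers; positions in row or column \<open>0\<close> or \<open>n + 1\<close> are never in the diagram.
\<close>

definition rank_fun :: "nat \<Rightarrow> (nat \<Rightarrow> nat) \<Rightarrow> nat \<Rightarrow> nat \<Rightarrow> nat" where
  "rank_fun n w p q = card {k \<in> {1..n}. k \<le> q \<and> w k \<ge> p}"

definition diagram :: "nat \<Rightarrow> (nat \<Rightarrow> nat) \<Rightarrow> (nat \<times> nat) set" where
  "diagram n w = {(p, q). p \<in> {1..n} \<and> q \<in> {1..n} \<and> w q < p \<and> inv w p > q}"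

definition essential_set :: "nat \<Rightarrow> (nat \<Rightarrow> nat) \<Rightarrow> (nat \<times> nat) set" where
  "essential_set n w =
     {(p, q). (p, q) \<in> diagram n w \<and> (p, q + 1) \<notin> diagram n w \<and> (p - 1, q) \<notin> diagram n w}"

definition perm_length :: "nat \<Rightarrow> (nat \<Rightarrow> nat) \<Rightarrow> nat" where
  "perm_length n w = card {(i, j). i \<in> {1..n} \<and> j \<in> {1..n} \<and> i < j \<and> w i > w j}"

definition defined_by_inclusions :: "nat \<Rightarrow> (nat \<Rightarrow> nat) \<Rightarrow> bool" where
  "defined_by_inclusions n w \<longleftrightarrow>
     (\<forall>(p, q) \<in> essential_set n w. int q - int (rank_fun n w p q) = min (int p - 1) (int q))"

definition cond_A :: "nat \<Rightarrow> (nat \<Rightarrow> nat) \<Rightarrow> nat \<Rightarrow> nat \<Rightarrow> bool" where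
  "cond_A n w p q \<longleftrightarrow> \<not> (\<exists>k \<in> {1..n}. k \<le> q \<and> w k \<ge> p)"

definition cond_B :: "nat \<Rightarrow> (nat \<Rightarrow> nat) \<Rightarrow> nat \<Rightarrow> nat \<Rightarrow> bool" where
  "cond_B n w p q \<longleftrightarrow> \<not> (\<exists>k \<in> {1..n}. k > q \<and> w k < p)"

definition cond_W :: "nat \<Rightarrow> (nat \<Rightarrow> nat) \<Rightarrow> nat \<Rightarrow> nat \<Rightarrow> bool" where
  "cond_W n w p q \<longleftrightarrow>
     (\<forall>p' < p. (p', q) \<notin> essential_set n w) \<and>
     ((p, q - 1) \<notin> diagram n w \<or>
      (\<exists>p' < p. (p', q - 1) \<in> essential_set n w \<and> cond_B n w p' (q - 1) \<and>
                rank_fun n w p' (q - 1) = rank_fun n w p q))"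

text \<open>
  In \<open>cond_X\<close> and \<open>cond_Z\<close> below, the least (greatest) element exists because the box
  \<open>(p', q)\<close> (respectively \<open>(p, q')\<close>) lies in the diagram, which is contained in \<open>{1..n} \<times> {1..n}\<close>.
  In particular the least element in \<open>cond_X\<close> is at least \<open>1\<close>, so the subtraction is not truncated.
\<close>

definition cond_X :: "nat \<Rightarrow> (nat \<Rightarrow> nat) \<Rightarrow> nat \<Rightarrow> nat \<Rightarrow> bool" where
  "cond_X n w p q \<longleftrightarrow>
     (\<exists>p' < p. (p', q) \<in> essential_set n w \<and>
        (\<forall>a < p. (a, q) \<in> essential_set n w \<longrightarrow> a = p') \<and>
        cond_B n w p' q \<and>
        rank_fun n w p' q = rank_fun n w p q + 1 \<and>
        (p, (LEAST q'. \<forall>b \<in> {q'..q}. (p', b) \<in> diagram n w) - 1) \<in> diagram n w)"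

definition cond_Y :: "nat \<Rightarrow> (nat \<Rightarrow> nat) \<Rightarrow> nat \<Rightarrow> nat \<Rightarrow> bool" where
  "cond_Y n w p q \<longleftrightarrow>
     (\<forall>q' > q. (p, q') \<notin> essential_set n w) \<and>
     ((p + 1, q) \<notin> diagram n w \<or>
      (\<exists>q' > q. (p + 1, q') \<in> essential_set n w \<and> cond_B n w (p + 1) q' \<and>
                rank_fun n w (p + 1) q' = rank_fun n w p q))"

definition cond_Z :: "nat \<Rightarrow> (nat \<Rightarrow> nat) \<Rightarrow> nat \<Rightarrow> nat \<Rightarrow> bool" where
  "cond_Z n w p q \<longleftrightarrow>
     (\<exists>q' > q. (p, q') \<in> essential_set n w \<and>
        (\<forall>b > q. (p, b) \<in> essential_set n w \<longrightarrow> b = q') \<and>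
        cond_B n w p q' \<and>
        rank_fun n w p q' = rank_fun n w p q + 1 \<and>
        ((GREATEST p'. \<forall>a \<in> {p..p'}. (a, q') \<in> diagram n w) + 1, q) \<in> diagram n w)"

definition almost_defined_by_inclusions :: "nat \<Rightarrow> (nat \<Rightarrow> nat) \<Rightarrow> bool" where
  "almost_defined_by_inclusions n w \<longleftrightarrow>
     (\<forall>(p, q) \<in> essential_set n w.
        cond_A n w p q \<or> cond_B n w p q \<or>
        ((cond_W n w p q \<or> cond_X n w p q) \<and> (cond_Y n w p q \<or> cond_Z n w p q)))"

definition essential_set'' :: "nat \<Rightarrow> (nat \<Rightarrow> nat) \<Rightarrow> (nat \<times> nat) set" where
  "essential_set'' n w =
     {(p, q). (p, q) \<in> essential_set n w \<and> \<not> cond_A n w p q \<and> \<not> cond_B n w p q}"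

end

theory Submission
  imports Defs
begin

text \<open>
  The boxes of \<open>E''(w)\<close> can be removed one at a time.  For such a box \<open>(p, q)\<close>, condition W or X
  provides a dot \<open>(w i, i)\<close> above row \<open>p\<close> and weakly left of column \<open>q\<close> (\<open>i = q\<close> for W,
  \<open>w i = p - 1\<close> for X), and condition Y or Z a dot \<open>(w j, j)\<close> weakly below row \<open>p\<close> and right of
  column \<open>q\<close> (\<open>w j = p\<close> for Y, \<open>j = q + 1\<close> for Z).  There is no dot inside the rectangle spanned by
  these two, and \<open>(p, q)\<close> is the only essential box among the positions whose rank changes when the
  two dots are exchanged.  So the exchange adds one inversion; inspecting the new diagram shows that
  it deletes exactly \<open>(p, q)\<close> from the essential set, and that the hypotheses on the remaining
  boxes survive.

  Uniqueness holds because the ranks on its essential set determine a permutation.  The remaining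
  boxes satisfy A or B, which say that the rank is \<open>0\<close> or \<open>q - (p - 1)\<close>, hence \<open>v\<close> is defined by
  inclusions.
\<close>

section \<open>Ranks and essential sets\<close>

text \<open>The last term counts the dots in the L-shaped region between the two corners. It turns
  ranks into statements about dots: equal ranks leave the L empty, and a difference of one leaves
  exactly one dot in it.\<close>

lemma rank_fun_split:
  assumes "p' \<le> p" "q \<le> q'"
  shows "rank_fun n w p' q' = rank_fun n w p q +
           card {k \<in> {1..n}. k \<le> q' \<and> p' \<le> w k \<and> \<not> (k \<le> q \<and> p \<le> w k)}"
proof -
  have "{k \<in> {1..n}. k \<le> q' \<and> p' \<le> w k} = {k \<in> {1..n}. k \<le> q \<and> p \<le> w k} \<union>
      {k \<in> {1..n}. k \<le> q' \<and> p' \<le> w k \<and> \<not> (k \<le> q \<and> p \<le> w k)}"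
    using assms by auto
  then show ?thesis
    unfolding rank_fun_def by (simp only:) (subst card_Un_disjoint; auto)
qed

lemma rank_fun_mono:
  "p' \<le> p \<Longrightarrow> q \<le> q' \<Longrightarrow> rank_fun n w p q \<le> rank_fun n w p' q'"
  using rank_fun_split[of p' p q q' n w] by simp

lemma rank_fun_eqD:
  assumes "rank_fun n w p' q' = rank_fun n w p q" "p' \<le> p" "q \<le> q'"
    and "k \<in> {1..n}" "k \<le> q'" "p' \<le> w k"
  shows "k \<le> q \<and> p \<le> w k"
  using rank_fun_split[of p' p q q' n w] assms by auto

lemma rank_fun_Suc_unique:
  assumes "rank_fun n w p' q' = rank_fun n w p q + 1" "p' \<le> p" "q \<le> q'"
    and k: "k \<in> {1..n}" "k \<le> q'" "p' \<le> w k" "\<not> (k \<le> q \<and> p \<le> w k)"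
    and l: "l \<in> {1..n}" "l \<le> q'" "p' \<le> w l" "\<not> (l \<le> q \<and> p \<le> w l)"
  shows "k = l"
proof -
  let ?A = "{k \<in> {1..n}. k \<le> q' \<and> p' \<le> w k \<and> \<not> (k \<le> q \<and> p \<le> w k)}"
  have "card ?A = 1"
    using rank_fun_split[of p' p q q' n w] assms(1-3) by simp
  then obtain x where "?A = {x}"
    by (rule card_1_singletonE)
  moreover have "k \<in> ?A" "l \<in> ?A"
    using k l by blast+
  ultimately show ?thesis
    by (simp only: singleton_iff)
qed

lemma rank_fun_Suc_row_unique:
  assumes "rank_fun n w p' q = rank_fun n w p q + 1" "p' \<le> p"
    and "k \<in> {1..n}" "k \<le> q" "p' \<le> w k" "w k < p"
    and "l \<in> {1..n}" "l \<le> q" "p' \<le> w l" "w l < p"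
  shows "k = l"
  using rank_fun_Suc_unique[OF assms(1,2) order_refl assms(3-5) _ assms(7-9)] assms(6,10)
  by simp

lemma rank_fun_step_column:
  assumes "q + 1 \<le> n"
  shows "rank_fun n w p (q + 1) = rank_fun n w p q + (if p \<le> w (q + 1) then 1 else 0)"
proof -
  have "{k \<in> {1..n}. k \<le> q + 1 \<and> p \<le> w k \<and> \<not> (k \<le> q \<and> p \<le> w k)}
      = (if p \<le> w (q + 1) then {q + 1} else {})"
    using assms by (auto simp: le_Suc_eq)
  then show ?thesis
    using rank_fun_split[of p p q "q + 1" n w] by simp
qed

lemma rank_fun_step_row:
  assumes "w permutes {1..n}" "p \<in> {1..n}"
  shows "rank_fun n w p q = rank_fun n w (p + 1) q + (if inv w p \<le> q then 1 else 0)"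
proof -
  have w: "inv w p \<in> {1..n}" "w (inv w p) = p"
    using assms permutes_in_image[OF permutes_inv[OF assms(1)]] permutes_inverses[OF assms(1)]
    by auto
  have "{k \<in> {1..n}. k \<le> q \<and> p \<le> w k \<and> \<not> (k \<le> q \<and> p + 1 \<le> w k)}
      = {k \<in> {1..n}. k \<le> q \<and> w k = p}"
    by auto
  also have "\<dots> = (if inv w p \<le> q then {inv w p} else {})"
    using w permutes_inverses[OF assms(1)] by auto
  finally show ?thesis
    using rank_fun_split[of p "p + 1" q q n w] by simp
qed

lemma cond_A_iff_rank: "cond_A n w p q \<longleftrightarrow> rank_fun n w p q = 0"
  by (auto simp: cond_A_def rank_fun_def)

text \<open>There are \<open>p - 1\<close> dots above row \<open>p\<close>, of which
  \<open>q - rank_fun n w p q\<close> lie in the first \<open>q\<close> columns; Condition B says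
  that none is left over. Hence B, like A, depends only on the position and the rank there.\<close>

lemma cond_B_iff_rank:
  assumes "w permutes {1..n}" "1 \<le> p" "p \<le> n + 1" "q \<le> n"
  shows "cond_B n w p q \<longleftrightarrow> q + 1 = rank_fun n w p q + p"
proof -
  let ?L = "{k \<in> {1..n}. w k < p}"
  have "w ` ?L = {1..<p}"
  proof
    show "w ` ?L \<subseteq> {1..<p}"
      using permutes_in_image[OF assms(1)] by fastforce
    show "{1..<p} \<subseteq> w ` ?L"
    proof
      fix a assume a: "a \<in> {1..<p}"
      then have "inv w a \<in> {1..n}" "w (inv w a) = a"
        using assms permutes_in_image[OF permutes_inv[OF assms(1)], of a]
          permutes_inverses[OF assms(1)] by auto
      with a show "a \<in> w ` ?L" by (intro image_eqI[of _ _ "inv w a"]) auto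
    qed
  qed
  then have L: "card ?L = p - 1"
    using card_image[of w ?L] permutes_inj_on[OF assms(1)] by simp
  define c where "c = card {k \<in> {1..n}. k \<le> q \<and> w k < p}"
  define d where "d = card {k \<in> {1..n}. q < k \<and> w k < p}"
  have "?L = {k \<in> {1..n}. k \<le> q \<and> w k < p} \<union> {k \<in> {1..n}. q < k \<and> w k < p}"
    by auto
  also have "card \<dots> = c + d"
    unfolding c_def d_def by (rule card_Un_disjoint) auto
  finally have "p - 1 = c + d" unfolding L .
  moreover have "{1..q} = {k \<in> {1..n}. k \<le> q \<and> p \<le> w k} \<union> {k \<in> {1..n}. k \<le> q \<and> w k < p}"
    using assms by auto
  then have "card {1..q} = card ({k \<in> {1..n}. k \<le> q \<and> p \<le> w k} \<union> {k \<in> {1..n}. k \<le> q \<and> w k < p})"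
    by (rule arg_cong)
  then have "card {1..q} = rank_fun n w p q + c"
    unfolding rank_fun_def c_def by (subst (asm) card_Un_disjoint) auto
  moreover have "cond_B n w p q \<longleftrightarrow> d = 0"
    by (auto simp: cond_B_def d_def)
  ultimately show ?thesis
    using assms(2) by auto
qed

section \<open>Diagrams, and how essential ranks determine a permutation\<close>

lemma diagram_iff:
  assumes "w permutes {1..n}"
  shows "(p, q) \<in> diagram n w \<longleftrightarrow> 1 \<le> q \<and> p \<le> n \<and> w q < p \<and> q < inv w p"
  using permutes_in_image[OF permutes_inv[OF assms], of p]
  by (auto simp: diagram_def)

text \<open>
  Off the diagram one walks left or down, on the diagram up or right, until the rank function is
  known: so the ranks at the essential boxes bound the rank function of any other permutation.
\<close>

lemma rank_fun_le_diagram: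
  assumes w: "w permutes {1..n}"
    and E: "\<And>p q. (p, q) \<in> essential_set n w \<Longrightarrow> rank_fun n v p q \<le> rank_fun n w p q"
    and "(p, q) \<in> diagram n w"
  shows "rank_fun n v p q \<le> rank_fun n w p q"
  using assms(3)
proof (induction "p + (n - q)" arbitrary: p q rule: less_induct)
  case less
  then have pq: "1 \<le> q" "q \<le> n" "1 \<le> p" "p \<le> n" "w q < p" "q < inv w p"
    by (auto simp: diagram_def)
  consider "(p, q) \<in> essential_set n w" | "(p, q + 1) \<in> diagram n w" | "(p - 1, q) \<in> diagram n w"
    using less.prems by (auto simp: essential_set_def)
  then show ?case
  proof cases
    case 1
    then show ?thesis by (rule E)
  next
    case 2
    then have "q + 1 \<le> n" "w (q + 1) < p" by (auto simp: diagram_def)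
    then have "rank_fun n w p (q + 1) = rank_fun n w p q"
      using rank_fun_step_column[of q n w p] by simp
    moreover have "rank_fun n v p (q + 1) \<le> rank_fun n w p (q + 1)"
      using less.hyps[OF _ 2] \<open>q + 1 \<le> n\<close> by simp
    ultimately show ?thesis
      using rank_fun_mono[of p p q "q + 1" n v] by simp
  next
    case 3
    then have "p - 1 \<in> {1..n}" "q < inv w (p - 1)" by (auto simp: diagram_def)
    then have "rank_fun n w (p - 1) q = rank_fun n w p q"
      using rank_fun_step_row[OF w, of "p - 1" q] pq(3) by simp
    moreover have "rank_fun n v (p - 1) q \<le> rank_fun n w (p - 1) q"
      using less.hyps[OF _ 3] pq by simp
    ultimately show ?thesis
      using rank_fun_mono[of "p - 1" p q q n v] by simp
  qed
qed

lemma rank_fun_le_everywhere: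
  assumes w: "w permutes {1..n}" and v: "v permutes {1..n}"
    and E: "\<And>p q. (p, q) \<in> essential_set n w \<Longrightarrow> rank_fun n v p q \<le> rank_fun n w p q"
    and "1 \<le> p" "q \<le> n"
  shows "rank_fun n v p q \<le> rank_fun n w p q"
  using assms(4,5)
proof (induction "q + (n + 1 - p)" arbitrary: p q rule: less_induct)
  case less
  \<comment> \<open>Off the diagram, the dot of column \<open>q\<close> is weakly below row
    \<open>p\<close> or the dot of row \<open>p\<close> is weakly left of column \<open>q\<close>.
    Dropping that column or row lowers the rank of \<open>w\<close> by exactly one and that of
    \<open>v\<close> by at most one, so the bound carries back.\<close>
  consider "q = 0" | "n < p" | "q \<noteq> 0" "p \<le> n" "(p, q) \<in> diagram n w" | "q \<noteq> 0" "p \<le> n" "p \<le> w q"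
    | "p \<le> n" "inv w p \<le> q"
    using less.prems diagram_iff[OF w, of p q] by fastforce
  then show ?case
  proof cases
    case 1
    then have "rank_fun n v p q = 0" by (auto simp: rank_fun_def)
    then show ?thesis by simp
  next
    case 2
    then have "v k < p" if "k \<in> {1..n}" for k
      using permutes_in_image[OF v, of k] that by simp
    then have "rank_fun n v p q = 0" by (auto simp: rank_fun_def not_le)
    then show ?thesis by simp
  next
    case 3
    show ?thesis by (rule rank_fun_le_diagram[OF w E 3(3)])
  next
    case 4
    then have q: "q - 1 + 1 = q" by simp
    have "rank_fun n v p (q - 1) \<le> rank_fun n w p (q - 1)"
      using 4 less.prems by (intro less.hyps) auto
    then show ?thesis
      using rank_fun_step_column[of "q - 1" n w p] rank_fun_step_column[of "q - 1" n v p]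
        4 less.prems unfolding q by auto
  next
    case 5
    have "rank_fun n v (p + 1) q \<le> rank_fun n w (p + 1) q"
      using 5 less.prems by (intro less.hyps) auto
    then show ?thesis
      using rank_fun_step_row[OF w, of p q] rank_fun_step_row[OF v, of p q]
        5 less.prems by auto
  qed
qed

text \<open>Adding column \<open>k\<close> raises the rank at row \<open>p\<close> exactly when
  \<open>p \<le> w k\<close>; as \<open>p\<close> varies, this recovers \<open>w k\<close>.\<close>

lemma permutation_eq_if_ranks_eq:
  assumes w: "w permutes {1..n}" and v: "v permutes {1..n}"
    and eq: "\<And>p q. 1 \<le> p \<Longrightarrow> q \<le> n \<Longrightarrow> rank_fun n v p q = rank_fun n w p q"
  shows "v = w"
proof
  fix k
  show "v k = w k"
  proof (cases "k \<in> {1..n}")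
    case True
    then obtain m where m: "k = m + 1" "m + 1 \<le> n"
      using Suc_le_D by auto
    have "p \<le> v k \<longleftrightarrow> p \<le> w k" if "1 \<le> p" for p
      using rank_fun_step_column[OF m(2), of w p] rank_fun_step_column[OF m(2), of v p]
        eq[OF that, of m] eq[OF that, of k] m by (simp split: if_splits)
    moreover have "1 \<le> v k" "1 \<le> w k"
      using True permutes_in_image[OF w, of k] permutes_in_image[OF v, of k] by auto
    ultimately show ?thesis by (meson le_antisym order_refl)
  next
    case False
    then show ?thesis using w v by (simp add: permutes_not_in)
  qed
qed

text \<open>The bound by essential ranks applies with either permutation as the one whose diagram is
  walked, so all ranks agree.\<close>

lemma essential_data_determine_permutation:
  assumes "w permutes {1..n}" "v permutes {1..n}" "essential_set n v = essential_set n w"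
    and "\<And>p q. (p, q) \<in> essential_set n w \<Longrightarrow> rank_fun n v p q = rank_fun n w p q"
  shows "v = w"
proof (rule permutation_eq_if_ranks_eq[OF assms(1,2)])
  fix p q :: nat
  assume pq: "1 \<le> p" "q \<le> n"
  have "rank_fun n v p q \<le> rank_fun n w p q"
    by (rule rank_fun_le_everywhere[OF assms(1,2) _ pq]) (simp add: assms(4))
  moreover have "rank_fun n w p q \<le> rank_fun n v p q"
    by (rule rank_fun_le_everywhere[OF assms(2,1) _ pq]) (simp add: assms(3,4))
  ultimately show "rank_fun n v p q = rank_fun n w p q"
    by simp
qed

section \<open>Reflection in the antidiagonal\<close>

text \<open>This is the inverse of \<open>w\<close> conjugated by the order reversal of
  \<open>{1..n}\<close>: the dot \<open>(w j, j)\<close> goes to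
  \<open>(n + 1 - j, n + 1 - w j)\<close>. The reflection interchanges up and right, the two
  directions in which diagrams and essential boxes are defined.\<close>

definition antitranspose :: "nat \<Rightarrow> (nat \<Rightarrow> nat) \<Rightarrow> nat \<Rightarrow> nat" where
  "antitranspose n w k = (if k \<in> {1..n} then n + 1 - inv w (n + 1 - k) else k)"

lemma antitranspose_works:
  assumes "w permutes {1..n}"
  shows antitranspose_permutes: "antitranspose n w permutes {1..n}"
    and inv_antitranspose: "inv (antitranspose n w) = antitranspose n (inv w)"
proof -
  have u: "inv w permutes {1..n}" "inv (inv w) = w"
    using assms by (simp_all add: permutes_inv permutes_inv_inv)
  have 1: "antitranspose n w (antitranspose n (inv w) k) = k" for k
    using permutes_in_image[OF assms, of "n + 1 - k"] permutes_inverses[OF assms]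
    by (auto simp: antitranspose_def u)
  have 2: "antitranspose n (inv w) (antitranspose n w k) = k" for k
    using permutes_in_image[OF u(1), of "n + 1 - k"] permutes_inverses[OF assms]
    by (auto simp: antitranspose_def u)
  have b: "bij (antitranspose n w)"
    by (rule o_bij[of "antitranspose n (inv w)"]) (auto simp: fun_eq_iff 1 2)
  show "antitranspose n w permutes {1..n}"
    using b by (auto simp: permutes_def antitranspose_def bij_iff)
  show "inv (antitranspose n w) = antitranspose n (inv w)"
    by (rule inv_unique_comp) (auto simp: fun_eq_iff 1 2)
qed

lemma antitranspose_antitranspose:
  assumes "w permutes {1..n}"
  shows "antitranspose n (antitranspose n w) = w"
proof
  fix k
  have "inv (inv w) = w" using assms by (simp add: permutes_inv_inv)
  then show "antitranspose n (antitranspose n w) k = w k"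
    using permutes_in_image[OF assms, of k] permutes_not_in[OF assms, of k]
    by (subst antitranspose_def) (auto simp: inv_antitranspose[OF assms] antitranspose_def)
qed

lemma diagram_antitranspose:
  assumes w: "w permutes {1..n}" and "p \<le> n + 1" "q \<le> n + 1"
  shows "(p, q) \<in> diagram n (antitranspose n w) \<longleftrightarrow> (n + 1 - q, n + 1 - p) \<in> diagram n w"
proof (cases "p \<in> {1..n} \<and> q \<in> {1..n}")
  case True
  have "inv w (n + 1 - q) \<in> {1..n}" "w (n + 1 - p) \<in> {1..n}"
    using True permutes_in_image[OF permutes_inv[OF w], of "n + 1 - q"]
      permutes_in_image[OF w, of "n + 1 - p"] by auto
  moreover have "inv (inv w) = w" using w by (simp add: permutes_inv_inv)
  moreover have "n + 1 - a < b \<longleftrightarrow> n + 1 - b < a" "b < n + 1 - a \<longleftrightarrow> a < n + 1 - b"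
    if "a \<in> {1..n}" "b \<in> {1..n}" for a b
    using that by auto
  ultimately show ?thesis
    using True by (auto simp: diagram_def inv_antitranspose[OF w] antitranspose_def)
next
  case False
  then show ?thesis using assms by (auto simp: diagram_def)
qed

text \<open>The right and the upper neighbour trade places, so the two exclusions that define
  essential boxes are interchanged.\<close>

lemma essential_set_antitranspose:
  assumes w: "w permutes {1..n}" and "p \<le> n + 1" "q \<le> n + 1"
  shows "(p, q) \<in> essential_set n (antitranspose n w) \<longleftrightarrow> (n + 1 - q, n + 1 - p) \<in> essential_set n w"
proof (cases "p \<in> {1..n} \<and> q \<in> {1..n}")
  case True
  have "(p, q) \<in> diagram n (antitranspose n w) \<longleftrightarrow> (n + 1 - q, n + 1 - p) \<in> diagram n w"
    using assms by (intro diagram_antitranspose)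
  moreover have "(p, q + 1) \<in> diagram n (antitranspose n w) \<longleftrightarrow> (n + 1 - q - 1, n + 1 - p) \<in> diagram n w"
    using True by (subst diagram_antitranspose[OF w]) auto
  moreover have "n + 1 - (p - 1) = n + 1 - p + 1"
    using True by auto
  then have "(p - 1, q) \<in> diagram n (antitranspose n w) \<longleftrightarrow> (n + 1 - q, n + 1 - p + 1) \<in> diagram n w"
    using True by (subst diagram_antitranspose[OF w]) auto
  ultimately show ?thesis
    unfolding essential_set_def mem_Collect_eq prod.case by blast
next
  case False
  then have "(p, q) \<notin> diagram n (antitranspose n w)"
    by (auto simp: diagram_def)
  moreover from this have "(n + 1 - q, n + 1 - p) \<notin> diagram n w"
    unfolding diagram_antitranspose[OF assms] .
  ultimately show ?thesis
    by (simp add: essential_set_def)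
qed

text \<open>The reflection matches the dots counted on both sides: columns up to \<open>q\<close>
  become rows from \<open>n + 1 - q\<close> on, and rows from \<open>p\<close> on become columns up
  to \<open>n + 1 - p\<close>.\<close>

lemma rank_fun_antitranspose:
  assumes w: "w permutes {1..n}" and "1 \<le> p" "p \<le> n + 1" "q \<le> n"
  shows "rank_fun n (antitranspose n w) p q = rank_fun n w (n + 1 - q) (n + 1 - p)"
proof -
  let ?f = "\<lambda>k. inv w (n + 1 - k)" and ?g = "\<lambda>l. n + 1 - w l"
  have w': "k \<in> {1..n} \<Longrightarrow> w k \<in> {1..n}" "k \<in> {1..n} \<Longrightarrow> inv w k \<in> {1..n}" for k
    using permutes_in_image[OF w, of k] permutes_in_image[OF permutes_inv[OF w], of k] by auto
  have "bij_betw ?f {k \<in> {1..n}. k \<le> q \<and> p \<le> antitranspose n w k}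
      {k \<in> {1..n}. k \<le> n + 1 - p \<and> n + 1 - q \<le> w k}"
  proof (rule bij_betw_byWitness[where f' = ?g])
    show "\<forall>k\<in>{k \<in> {1..n}. k \<le> q \<and> p \<le> antitranspose n w k}. ?g (?f k) = k"
      using permutes_inverses[OF w] by auto
    have "?f (?g l) = l" if "l \<in> {1..n}" for l
      using permutes_inverses(2)[OF w, of l] w'(1)[OF that] by simp
    then show "\<forall>l\<in>{k \<in> {1..n}. k \<le> n + 1 - p \<and> n + 1 - q \<le> w k}. ?f (?g l) = l"
      by simp
    show "?f ` {k \<in> {1..n}. k \<le> q \<and> p \<le> antitranspose n w k}
        \<subseteq> {k \<in> {1..n}. k \<le> n + 1 - p \<and> n + 1 - q \<le> w k}"
    proof clarify
      fix k assume k: "k \<in> {1..n}" "k \<le> q" "p \<le> antitranspose n w k"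
      then have "?f k \<in> {1..n}" by (intro w') auto
      with k show "?f k \<in> {1..n} \<and> ?f k \<le> n + 1 - p \<and> n + 1 - q \<le> w (?f k)"
        using permutes_inverses[OF w] assms(2) by (auto simp: antitranspose_def)
    qed
    show "?g ` {k \<in> {1..n}. k \<le> n + 1 - p \<and> n + 1 - q \<le> w k}
        \<subseteq> {k \<in> {1..n}. k \<le> q \<and> p \<le> antitranspose n w k}"
    proof clarify
      fix l assume l: "l \<in> {1..n}" "l \<le> n + 1 - p" "n + 1 - q \<le> w l"
      then have "w l \<in> {1..n}" by (intro w')
      with l show "?g l \<in> {1..n} \<and> ?g l \<le> q \<and> p \<le> antitranspose n w (?g l)"
        using permutes_inverses[OF w] assms by (auto simp: antitranspose_def)
    qed
  qed
  then show ?thesis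
    unfolding rank_fun_def by (rule bij_betw_same_card)
qed

lemma cond_B_antitranspose:
  assumes w: "w permutes {1..n}" and "1 \<le> p" "p \<le> n + 1" "q \<le> n"
  shows "cond_B n (antitranspose n w) p q \<longleftrightarrow> cond_B n w (n + 1 - q) (n + 1 - p)"
  using cond_B_iff_rank[OF w, of "n + 1 - q" "n + 1 - p"] rank_fun_antitranspose[OF assms] assms
    cond_B_iff_rank[OF antitranspose_permutes[OF w], of p q]
  by auto

text \<open>Exchanging columns \<open>i\<close> and \<open>j\<close> of \<open>w\<close> exchanges
  two rows of the reflection, which amounts to exchanging the columns \<open>n + 1 - w i\<close> and
  \<open>n + 1 - w j\<close> of the reflected dots.\<close>

lemma antitranspose_transpose:
  assumes w: "w permutes {1..n}" and "i \<in> {1..n}" "j \<in> {1..n}"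
  shows "antitranspose n (w \<circ> transpose i j) =
    antitranspose n w \<circ> transpose (n + 1 - w j) (n + 1 - w i)"
proof
  fix k
  have inv: "inv (w \<circ> transpose i j) = transpose i j \<circ> inv w"
    using w by (subst o_inv_distrib) (auto simp: permutes_bij)
  have ij: "w i \<in> {1..n}" "w j \<in> {1..n}"
    using assms permutes_in_image[OF w] by auto
  have conj: "transpose i j (inv w l) = inv w (transpose (w i) (w j) l)" for l
    using permutes_inv_eq[OF w, of l i] permutes_inv_eq[OF w, of l j] permutes_inverses(2)[OF w]
    by (auto simp: transpose_def)
  show "antitranspose n (w \<circ> transpose i j) k =
    (antitranspose n w \<circ> transpose (n + 1 - w j) (n + 1 - w i)) k"
  proof (cases "k \<in> {1..n}")
    case True
    define m where "m = transpose (w i) (w j) (n + 1 - k)"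
    have m: "m \<in> {1..n}"
      using ij True by (auto simp: m_def transpose_def)
    have "transpose (n + 1 - w j) (n + 1 - w i) k = n + 1 - m"
      using ij True by (auto simp: m_def transpose_def)
    moreover have "antitranspose n w (n + 1 - m) = n + 1 - inv w m"
      using m by (auto simp: antitranspose_def)
    moreover have "antitranspose n (w \<circ> transpose i j) k = n + 1 - inv w m"
      using True by (simp add: antitranspose_def inv conj m_def)
    ultimately show ?thesis
      by simp
  next
    case False
    then show ?thesis
      using ij by (auto simp: antitranspose_def transpose_def)
  qed
qed

section \<open>Exchanging two dots\<close>

lemma perm_length_transpose:
  assumes "i \<in> {1..n}" "j \<in> {1..n}" "i < j" "w i < w j"
    and between: "\<And>b. i < b \<Longrightarrow> b < j \<Longrightarrow> w b < w i \<or> w j < w b"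
  shows "perm_length n (w \<circ> transpose i j) = perm_length n w + 1"
proof -
  let ?t = "transpose i j"
  define v where "v = w \<circ> ?t"
  let ?I = "\<lambda>w. {(a, b). a \<in> {1..n} \<and> b \<in> {1..n} \<and> a < b \<and> w b < w a}"
  \<comment> \<open>\<open>f\<close> matches the inversions of \<open>w\<close> with those of
    \<open>v\<close> other than \<open>(i, j)\<close>. A pair starting before \<open>i\<close> has
    its second entry swapped, any other pair ending after \<open>j\<close> has its first entry
    swapped. Pairs inside \<open>[i, j]\<close> stay put, as no column strictly between has a value
    between \<open>w i\<close> and \<open>w j\<close>.\<close>
  define f where "f x = (if fst x < i then (fst x, ?t (snd x))
    else if j < snd x then (?t (fst x), snd x) else x)" for x
  have v: "v (?t a) = w a" "v i = w j" "v j = w i" for a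
    by (simp_all add: v_def)
  have v_other: "v a = w a" if "a \<noteq> i" "a \<noteq> j" for a
    using that by (simp add: v_def)
  have t: "?t a \<in> {1..n}" if "a \<in> {1..n}" for a
    using that assms by (simp add: transpose_def)
  have t_less: "a < i \<Longrightarrow> a < b \<Longrightarrow> a < ?t b" "j < b \<Longrightarrow> a < b \<Longrightarrow> ?t a < b" for a b
    using assms(3) by (simp_all add: transpose_def)
  have "?t a < i \<longleftrightarrow> a < i" for a
    using assms(3) by (simp add: transpose_def)
  then have f_f: "f (f x) = x" for x
    by (simp add: f_def)
  have "bij_betw f (?I w) (?I v - {(i, j)})"
  proof (rule bij_betw_byWitness[where f' = f])
    show "f ` ?I w \<subseteq> ?I v - {(i, j)}"
    proof (rule image_subsetI, elim CollectE case_prodE conjE)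
      fix x a b assume x: "x = (a, b)" and ab: "a \<in> {1..n}" "b \<in> {1..n}" "a < b" "w b < w a"
      consider "a < i" | "i \<le> a" "j < b" | "i \<le> a" "b \<le> j" by linarith
      then show "f x \<in> ?I v - {(i, j)}"
      proof cases
        case 1
        then show ?thesis
          using ab t[of b] t_less(1)[of a b] assms(3) v(1)[of b] v_other[of a]
          by (simp add: f_def x)
      next
        case 2
        then show ?thesis
          using ab t[of a] t_less(2)[of b a] assms(3) v(1)[of a] v_other[of b]
          by (simp add: f_def x)
      next
        case 3
        then have "v b < v a \<and> (a, b) \<noteq> (i, j)"
          using ab assms(3,4) between[of a] between[of b] v(2,3) v_other[of a] v_other[of b]
          by (cases "a = i"; cases "b = j") auto
        then show ?thesis
          using 3 ab by (simp add: f_def x)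
      qed
    qed
    show "f ` (?I v - {(i, j)}) \<subseteq> ?I w"
    proof (rule image_subsetI, elim DiffE CollectE case_prodE conjE)
      fix x a b assume x: "x = (a, b)" and ab: "a \<in> {1..n}" "b \<in> {1..n}" "a < b" "v b < v a"
        and "x \<notin> {(i, j)}"
      then have ne: "\<not> (a = i \<and> b = j)" by simp
      consider "a < i" | "i \<le> a" "j < b" | "i \<le> a" "b \<le> j" by linarith
      then show "f x \<in> ?I w"
      proof cases
        case 1
        then show ?thesis
          using ab t[of b] t_less(1)[of a b] assms(3) v(1)[of "?t b"] v_other[of a]
          by (simp add: f_def x)
      next
        case 2
        then show ?thesis
          using ab t[of a] t_less(2)[of b a] assms(3) v(1)[of "?t a"] v_other[of b]
          by (simp add: f_def x)
      next
        case 3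
        then have "w b < w a"
          using ab ne assms(3,4) between[of a] between[of b] v(2,3) v_other[of a] v_other[of b]
          by (cases "a = i"; cases "b = j") auto
        then show ?thesis
          using 3 ab by (simp add: f_def x)
      qed
    qed
  qed (simp_all add: f_f)
  then have card_eq: "card (?I w) = card (?I v - {(i, j)})"
    by (rule bij_betw_same_card)
  have "finite (?I v)"
    by (rule finite_subset[of _ "{1..n} \<times> {1..n}"]) auto
  moreover have "(i, j) \<in> ?I v"
    using assms v(2,3) by simp
  ultimately have "card (?I v) = Suc (card (?I v - {(i, j)}))"
    by (rule card.remove)
  then have "card (?I v) = card (?I w) + 1"
    unfolding card_eq by (simp only: Suc_eq_plus1)
  then show ?thesis
    by (simp add: perm_length_def v_def)
qed

text \<open>Away from the rectangle with rows \<open>{w i<..w j}\<close> and columns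
  \<open>{i..<j}\<close>, the two dots contribute the same total before and after the
  exchange.\<close>

lemma rank_fun_transpose:
  assumes "i \<in> {1..n}" "j \<in> {1..n}" "i < j"
    and "\<not> (w i < a \<and> a \<le> w j \<and> i \<le> b \<and> b < j)" "w i < w j"
  shows "rank_fun n (w \<circ> transpose i j) a b = rank_fun n w a b"
proof -
  have card_sum: "rank_fun n v a b = (\<Sum>k\<in>{1..n}. if k \<le> b \<and> a \<le> v k then 1 else 0)" for v
    by (simp add: rank_fun_def sum.If_cases Int_def)
  have split: "sum f {1..n} = sum f ({1..n} - {i, j}) + sum f {i, j}" for f :: "nat \<Rightarrow> nat"
    using assms(1,2) by (intro sum.subset_diff) auto
  have "sum (\<lambda>k. if k \<le> b \<and> a \<le> (w \<circ> transpose i j) k then 1 else 0) ({1..n} - {i, j})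
      = sum (\<lambda>k. if k \<le> b \<and> a \<le> w k then 1 else 0 :: nat) ({1..n} - {i, j})"
    by (rule sum.cong) (auto simp: transpose_def)
  then show ?thesis
    unfolding card_sum split using assms(3-5) by auto
qed

text \<open>The dot supplied by W (\<open>i = q\<close>) or X (\<open>i < q\<close>). The two
  universal clauses after the bounds keep dots out of the region between it and the box. The clause
  on \<open>(p, i - 1)\<close> ensures that this box, which loses its right neighbour, has a box
  above it; \<open>(p - 2, q)\<close> stops the new boxes in row \<open>w i\<close> from being
  essential. The clause on Condition B serves, after reflection, to keep the remaining boxes
  removable.\<close>

definition left_pivot :: "nat \<Rightarrow> (nat \<Rightarrow> nat) \<Rightarrow> nat \<Rightarrow> nat \<Rightarrow> nat \<Rightarrow> bool" where
  "left_pivot n w p q i \<longleftrightarrow>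
     1 \<le> i \<and> i \<le> q \<and> w i < p \<and>
     (\<forall>b. i < b \<and> b \<le> q \<longrightarrow> w b < w i) \<and>
     (\<forall>a. w i < a \<and> a < p \<longrightarrow> inv w a < i) \<and>
     ((p, i - 1) \<in> diagram n w \<longrightarrow> w i + 1 = p) \<and>
     (i < q \<longrightarrow> w i + 1 = p \<and> (p - 2, q) \<in> diagram n w \<and>
        (\<forall>a<p. (a, q) \<in> essential_set n w \<longrightarrow> cond_B n w a q))"

text \<open>The mirror image of \<open>left_pivot\<close> in the antidiagonal:
  \<open>w j = p\<close> for the dot supplied by Y, and \<open>p < w j\<close> with
  \<open>j = q + 1\<close> for Z.\<close>

definition right_pivot :: "nat \<Rightarrow> (nat \<Rightarrow> nat) \<Rightarrow> nat \<Rightarrow> nat \<Rightarrow> nat \<Rightarrow> bool" where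
  "right_pivot n w p q j \<longleftrightarrow>
     j \<le> n \<and> q < j \<and> p \<le> w j \<and>
     (\<forall>b. q < b \<and> b < j \<longrightarrow> w j < w b) \<and>
     (\<forall>a. p \<le> a \<and> a < w j \<longrightarrow> j < inv w a) \<and>
     ((w j + 1, q) \<in> diagram n w \<longrightarrow> j = q + 1) \<and>
     (p < w j \<longrightarrow> j = q + 1 \<and> (p, q + 2) \<in> diagram n w \<and>
        (\<forall>b>q. (p, b) \<in> essential_set n w \<longrightarrow> cond_B n w p b))"

section \<open>Effect of one exchange on diagram, essential set, ranks and length\<close>

locale exchange =
  fixes n :: nat and w :: "nat \<Rightarrow> nat" and p q i j :: nat
  assumes w: "w permutes {1..n}"
    and box: "(p, q) \<in> essential_set n w"
    and left: "left_pivot n w p q i"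
    and right: "right_pivot n w p q j"
begin

lemma box_bounds: "1 \<le> p" "p \<le> n" "1 \<le> q" "q \<le> n"
  using box by (auto simp: essential_set_def diagram_def)

lemma left_simps: "1 \<le> i" "i \<le> q" "w i < p"
  using left by (auto simp: left_pivot_def)

lemma left_column: "i < b \<Longrightarrow> b \<le> q \<Longrightarrow> w b < w i"
  using left by (auto simp: left_pivot_def)

lemma left_row: "w i < a \<Longrightarrow> a < p \<Longrightarrow> inv w a < i"
  using left by (auto simp: left_pivot_def)

lemma left_diagram: "(p, i - 1) \<in> diagram n w \<Longrightarrow> w i + 1 = p"
  using left by (auto simp: left_pivot_def)

lemma left_strict:
  assumes "i < q"
  shows "w i + 1 = p" "(p - 2, q) \<in> diagram n w"
    "a < p \<Longrightarrow> (a, q) \<in> essential_set n w \<Longrightarrow> cond_B n w a q"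
  using left assms by (auto simp: left_pivot_def)

lemma right_simps: "j \<le> n" "q < j" "p \<le> w j"
  using right by (auto simp: right_pivot_def)

lemma right_column: "q < b \<Longrightarrow> b < j \<Longrightarrow> w j < w b"
  using right by (auto simp: right_pivot_def)

lemma right_row: "p \<le> a \<Longrightarrow> a < w j \<Longrightarrow> j < inv w a"
  using right by (auto simp: right_pivot_def)

lemma right_diagram: "(w j + 1, q) \<in> diagram n w \<Longrightarrow> j = q + 1"
  using right by (auto simp: right_pivot_def)

lemma right_strict:
  assumes "p < w j"
  shows "j = q + 1" "(p, q + 2) \<in> diagram n w"
    "q < b \<Longrightarrow> (p, b) \<in> essential_set n w \<Longrightarrow> cond_B n w p b"
  using right assms by (auto simp: right_pivot_def)

lemma inv_eq_iff: "inv w a = b \<longleftrightarrow> w b = a"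
  using permutes_inv_eq[OF w] .

lemma w_eq_iff: "w a = w b \<longleftrightarrow> a = b"
  using permutes_inj[OF w] by (auto dest: injD)

lemma inv_w: "inv w (w a) = a" and w_inv: "w (inv w a) = a"
  using permutes_inverses[OF w] by auto

lemma pivots_in: "i \<in> {1..n}" "j \<in> {1..n}" "w j \<le> n"
  using left_simps right_simps box_bounds permutes_in_image[OF w, of j] by auto

abbreviation v :: "nat \<Rightarrow> nat" where
  "v \<equiv> w \<circ> transpose i j"

lemma v: "v permutes {1..n}"
  using pivots_in by (intro permutes_compose[OF _ w] permutes_swap_id)

lemma v_simps: "v i = w j" "v j = w i" "b \<noteq> i \<Longrightarrow> b \<noteq> j \<Longrightarrow> v b = w b"
  by auto

lemma inv_v_simps:
  "inv v (w j) = i" "inv v (w i) = j" "a \<noteq> w i \<Longrightarrow> a \<noteq> w j \<Longrightarrow> inv v a = inv w a"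
  using permutes_inv_eq[OF v] by (auto simp: inv_eq_iff inv_w w_inv transpose_def)

text \<open>The dots of columns \<open>i\<close> to \<open>q\<close> lie above row \<open>p\<close>,
  and those of rows \<open>p\<close> to \<open>w j\<close> lie to the right of column
  \<open>q\<close>.\<close>

lemma corner_subset_diagram:
  assumes "p \<le> a" "a \<le> w j" "i \<le> b" "b \<le> q"
  shows "(a, b) \<in> diagram n w"
proof -
  have "w b \<le> w i" using left_column[of b] assms by (cases "b = i") auto
  moreover have "j \<le> inv w a" using right_row[of a] assms by (cases "a = w j") (auto simp: inv_w)
  ultimately show ?thesis
    using assms left_simps right_simps pivots_in by (auto simp: diagram_iff[OF w])
qed

text \<open>In effect the corner rectangle loses only column \<open>i\<close> and row
  \<open>w j\<close>, while row \<open>w i\<close> gains columns \<open>i + 1\<close> to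
  \<open>q\<close> and column \<open>j\<close> gains rows \<open>p\<close> to
  \<open>w j - 1\<close>: one box fewer in total. Only rows \<open>w i\<close>, \<open>w j\<close>
  and columns \<open>i\<close>, \<open>j\<close> need inspection, since elsewhere the dots that
  decide membership do not move.\<close>

lemma diagram_exchange:
  "(a, b) \<in> diagram n v \<longleftrightarrow>
     (a, b) \<in> diagram n w \<and> \<not> (p \<le> a \<and> a \<le> w j \<and> i \<le> b \<and> b \<le> q) \<or>
     i < b \<and> b \<le> q \<and> (a = w i \<or> p \<le> a \<and> a < w j) \<or>
     b = j \<and> p \<le> a \<and> a < w j"
proof -
  note facts = left_simps right_simps pivots_in
  consider "a = w i" | "a = w j" | "a \<noteq> w i" "a \<noteq> w j" "b = i"
    | "a \<noteq> w i" "a \<noteq> w j" "b = j" | "a \<noteq> w i" "a \<noteq> w j" "b \<noteq> i" "b \<noteq> j" by blast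
  then show ?thesis
  proof cases
    case 1
    then have "(a, b) \<in> diagram n v \<longleftrightarrow> 1 \<le> b \<and> v b < w i \<and> b < j"
      using facts by (simp add: diagram_iff[OF v] inv_v_simps del: comp_apply)
    moreover have "(a, b) \<in> diagram n w \<longleftrightarrow> 1 \<le> b \<and> w b < w i \<and> b < i"
      using 1 facts by (simp add: diagram_iff[OF w] inv_w)
    ultimately show ?thesis
      using 1 facts left_column[of b] right_column[of b] v_simps(1) v_simps(3)[of b]
      by (cases "b = i"; cases "b \<le> q"; cases "b < i") (auto simp del: comp_apply)
  next
    case 2
    then have "(a, b) \<in> diagram n v \<longleftrightarrow> 1 \<le> b \<and> v b < w j \<and> b < i"
      using facts by (simp add: diagram_iff[OF v] inv_v_simps del: comp_apply)
    moreover have "(a, b) \<in> diagram n w \<longleftrightarrow> 1 \<le> b \<and> w b < w j \<and> b < j"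
      using 2 facts by (simp add: diagram_iff[OF w] inv_w)
    ultimately show ?thesis
      using 2 facts left_column[of b] right_column[of b] v_simps(3)[of b]
      by (cases "b = i"; cases "b \<le> q"; cases "b < i") (auto simp del: comp_apply)
  next
    case 3
    then have "(a, b) \<in> diagram n v \<longleftrightarrow> a \<le> n \<and> w j < a \<and> i < inv w a"
      using facts by (simp add: diagram_iff[OF v] inv_v_simps)
    moreover have "(a, b) \<in> diagram n w \<longleftrightarrow> a \<le> n \<and> w i < a \<and> i < inv w a"
      using 3 facts by (simp add: diagram_iff[OF w])
    ultimately show ?thesis
      using 3 facts left_row[of a] by auto
  next
    case 4
    then have "(a, b) \<in> diagram n v \<longleftrightarrow> a \<le> n \<and> w i < a \<and> j < inv w a"
      using facts by (simp add: diagram_iff[OF v] inv_v_simps)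
    moreover have "(a, b) \<in> diagram n w \<longleftrightarrow> a \<le> n \<and> w j < a \<and> j < inv w a"
      using 4 facts by (simp add: diagram_iff[OF w])
    ultimately show ?thesis
      using 4 facts left_row[of a] right_row[of a] by auto
  next
    case 5
    then have "(a, b) \<in> diagram n v \<longleftrightarrow> (a, b) \<in> diagram n w"
      by (simp add: diagram_iff[OF v] diagram_iff[OF w] inv_v_simps v_simps(3) del: comp_apply)
    then show ?thesis
      using 5 corner_subset_diagram[of a b] by auto
  qed
qed

lemma diagram_kept:
  assumes "(a, b) \<in> diagram n w" "\<not> (p \<le> a \<and> a \<le> w j \<and> i \<le> b \<and> b \<le> q)"
  shows "(a, b) \<in> diagram n v"
  using assms diagram_exchange by blast

lemma no_box_above:
  "w i < a \<Longrightarrow> a < p \<Longrightarrow> i \<le> b \<Longrightarrow> (a, b) \<notin> diagram n w"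
  using left_row[of a] by (auto simp: diagram_iff[OF w])

lemma no_box_right:
  "a \<le> w j \<Longrightarrow> q < b \<Longrightarrow> b < j \<Longrightarrow> (a, b) \<notin> diagram n w"
  using right_column[of b] by (auto simp: diagram_iff[OF w])

text \<open>The corner is a full rectangle of boxes, so only its upper right one can lack both
  neighbours.\<close>

lemma essential_in_corner:
  assumes "(a, b) \<in> essential_set n w" "p \<le> a" "a \<le> w j" "i \<le> b" "b \<le> q"
  shows "a = p \<and> b = q"
proof -
  have "(a, b + 1) \<notin> diagram n w" "(a - 1, b) \<notin> diagram n w"
    using assms(1) by (auto simp: essential_set_def)
  then have "\<not> b + 1 \<le> q" "\<not> p \<le> a - 1"
    using corner_subset_diagram[of a "b + 1"] corner_subset_diagram[of "a - 1" b] assms(2-5)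
    by force+
  then show ?thesis using assms(2,5) by linarith
qed

text \<open>Outside the corner, the rectangle on which ranks change contains no box at all.\<close>

lemma essential_in_rectangle:
  assumes "(a, b) \<in> essential_set n w" "w i < a" "a \<le> w j" "i \<le> b" "b < j"
  shows "a = p \<and> b = q"
proof -
  have "(a, b) \<in> diagram n w" using assms(1) by (simp add: essential_set_def)
  then have "p \<le> a" "b \<le> q"
    using no_box_above[of a b] no_box_right[of a b] assms by (auto simp: not_less[symmetric])
  then show ?thesis by (intro essential_in_corner) (use assms in auto)
qed

text \<open>Such a box lies outside the corner and so stays in the diagram; no newly created box can
  be its right or upper neighbour.\<close>

lemma essential_kept:
  assumes ab: "(a, b) \<in> essential_set n w" "(a, b) \<noteq> (p, q)"
  shows "(a, b) \<in> essential_set n v"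
proof -
  have D: "(a, b) \<in> diagram n w" "(a, b + 1) \<notin> diagram n w" "(a - 1, b) \<notin> diagram n w"
    using ab by (auto simp: essential_set_def)
  then have lt: "w b < a" "b < inv w a" "1 \<le> a" by (auto simp: diagram_def)
  have corner: "\<not> (p \<le> a \<and> a \<le> w j \<and> i \<le> b \<and> b \<le> q)"
    using essential_in_corner[OF ab(1)] ab(2) by blast
  have ai: "a = w i \<Longrightarrow> b < i"
    using lt(2) by (simp add: inv_w)
  have "(a, b) \<in> diagram n v"
    by (rule diagram_kept[OF D(1) corner])
  moreover have "(a, b + 1) \<notin> diagram n v"
  proof
    assume "(a, b + 1) \<in> diagram n v"
    then consider "i < b + 1" "b + 1 \<le> q" "a = w i" | "i < b + 1" "b + 1 \<le> q" "p \<le> a" "a < w j"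
      | "b + 1 = j" "p \<le> a" "a < w j"
      using D(2) diagram_exchange by blast
    then show False
    proof cases
      case 3
      then have "b = q" using right_strict(1) by simp
      then show ?thesis using corner 3 left_simps by simp
    qed (use corner ai in simp_all)
  qed
  moreover have "(a - 1, b) \<notin> diagram n v"
  proof
    assume "(a - 1, b) \<in> diagram n v"
    then consider "i < b" "b \<le> q" "a - 1 = w i" | "i < b" "b \<le> q" "p \<le> a - 1" "a - 1 < w j"
      | "b = j" "p \<le> a - 1" "a - 1 < w j"
      using D(3) diagram_exchange by blast
    then show False
    proof cases
      case 1
      then have "a = p" using left_strict(1) lt(3) by simp
      then show ?thesis using corner 1 right_simps by simp
    next
      case 2
      then have "p \<le> a" "a \<le> w j" by linarith+
      then show ?thesis using corner 2 by simp
    next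
      case 3
      then have "a \<le> w j" by linarith
      then show ?thesis using lt 3 by simp
    qed
  qed
  ultimately show ?thesis by (simp add: essential_set_def)
qed

text \<open>Two dangers are excluded: an old box could become essential by losing a neighbour to the
  exchange, and a newly created box could itself be essential.\<close>

lemma essential_reflected:
  assumes "(a, b) \<in> essential_set n v"
  shows "(a, b) \<in> essential_set n w \<and> (a, b) \<noteq> (p, q)"
proof -
  have D: "(a, b) \<in> diagram n v" "(a, b + 1) \<notin> diagram n v" "(a - 1, b) \<notin> diagram n v"
    using assms by (auto simp: essential_set_def)
  consider "(a, b) \<in> diagram n w" "\<not> (p \<le> a \<and> a \<le> w j \<and> i \<le> b \<and> b \<le> q)"
    | "i < b" "b \<le> q" "a = w i" | "i < b" "b \<le> q" "p \<le> a" "a < w j"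
    | "b = j" "p \<le> a" "a < w j"
    using D(1) diagram_exchange by blast
  then show ?thesis
  proof cases
    case 1
    have "(a, b + 1) \<notin> diagram n w"
    proof
      \<comment> \<open>A lost right neighbour lies in column \<open>i\<close>; then the box above
        \<open>(a, b)\<close> is in the old diagram and survives.\<close>
      assume right_box: "(a, b + 1) \<in> diagram n w"
      then have "p \<le> a \<and> a \<le> w j \<and> i \<le> b + 1 \<and> b + 1 \<le> q"
        using D(2) diagram_kept by blast
      with 1 have a: "p \<le> a" "a \<le> w j" and b: "i = b + 1"
        by auto
      have dot: "w b < a" "1 \<le> b" "a \<le> n" using 1(1) by (auto simp: diagram_iff[OF w])
      have "w b \<noteq> a - 1 \<and> b < inv w (a - 1)"
      proof (cases "a = p")
        case True
        then have "a - 1 = w i" using left_diagram 1(1) b by auto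
        then show ?thesis using b by (simp add: inv_w w_eq_iff)
      next
        case False
        then have "j < inv w (a - 1)" using right_row[of "a - 1"] a by simp
        moreover have "b < j" using b left_simps right_simps by simp
        ultimately show ?thesis using inv_w[of b] by auto
      qed
      then have "(a - 1, b) \<in> diagram n w"
        using dot by (auto simp: diagram_iff[OF w])
      then have "(a - 1, b) \<in> diagram n v"
        by (rule diagram_kept) (use b in simp)
      then show False using D(3) by contradiction
    qed
    moreover have "(a - 1, b) \<notin> diagram n w"
    proof
      \<comment> \<open>A lost upper neighbour lies in row \<open>w j\<close>; then the box to the
        right of \<open>(a, b)\<close> is in the old diagram and survives.\<close>
      assume upper_box: "(a - 1, b) \<in> diagram n w"
      then have "p \<le> a - 1 \<and> a - 1 \<le> w j \<and> i \<le> b \<and> b \<le> q"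
        using D(3) diagram_kept by blast
      with 1 have a: "a = w j + 1" and b: "i \<le> b" "b \<le> q"
        by auto
      have dot: "b < inv w a" "1 \<le> b" "a \<le> n" using 1(1) by (auto simp: diagram_iff[OF w])
      have "w (b + 1) < a"
      proof (cases "b = q")
        case True
        then have "j = q + 1" using right_diagram 1(1) a by simp
        then show ?thesis using True a by simp
      next
        case False
        then have "w (b + 1) < w i" using left_column[of "b + 1"] b by simp
        then show ?thesis using a left_simps right_simps by simp
      qed
      moreover from this have "b + 1 \<noteq> inv w a" using w_inv[of a] by auto
      ultimately have "(a, b + 1) \<in> diagram n w"
        using dot by (auto simp: diagram_iff[OF w])
      then have "(a, b + 1) \<in> diagram n v"
        by (rule diagram_kept) (use a in simp)
      then show False using D(2) by contradiction
    qed
    moreover have "(a, b) \<noteq> (p, q)"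
      using 1(2) left_simps right_simps by auto
    ultimately show ?thesis using 1(1) by (simp add: essential_set_def)
  next
    \<comment> \<open>A new box in row \<open>w i\<close> always has a right neighbour before column
      \<open>q\<close>; in column \<open>q\<close> the surviving box \<open>(p - 2, q)\<close> is
      above it.\<close>
    case 2
    then have "(a, b + 1) \<in> diagram n v \<or> b = q"
      by (subst diagram_exchange) auto
    then have b: "b = q" using D(2) by blast
    have "w i + 1 = p" "(p - 2, q) \<in> diagram n w"
      using left_strict(1,2) 2 by auto
    then have "(a - 1, b) \<in> diagram n w" "a - 1 < p"
      using 2 b by (auto simp: numeral_2_eq_2)
    then have "(a - 1, b) \<in> diagram n v"
      by (intro diagram_kept) auto
    then show ?thesis using D(3) by contradiction
  next
    \<comment> \<open>Here \<open>p < w j\<close>, so \<open>j = q + 1\<close> and the boxes of row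
      \<open>a\<close> continue without a gap into column \<open>j\<close>.\<close>
    case 3
    then have "(a, b + 1) \<in> diagram n v"
      using right_strict(1) by (subst diagram_exchange) auto
    then show ?thesis using D(2) by contradiction
  next
    \<comment> \<open>In column \<open>j\<close> only the top row \<open>p\<close> lacks an upper
      neighbour, and there \<open>(p, q + 2)\<close> is the neighbour to the right.\<close>
    case 4
    then have j: "j = q + 1" "(p, q + 2) \<in> diagram n w"
      using right_strict(1,2) by auto
    have "a = p"
    proof (rule ccontr)
      assume "a \<noteq> p"
      then have "(a - 1, b) \<in> diagram n v"
        using 4 by (subst diagram_exchange) auto
      then show False using D(3) by contradiction
    qed
    then have "(a, b + 1) \<in> diagram n v"
      using 4 j by (intro diagram_kept) auto
    then show ?thesis using D(2) by contradiction
  qed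
qed

lemma essential_set_exchange: "essential_set n v = essential_set n w - {(p, q)}"
  using essential_kept essential_reflected by auto

lemma rank_fun_exchange:
  assumes "(a, b) \<in> essential_set n v"
  shows "rank_fun n v a b = rank_fun n w a b"
proof (rule rank_fun_transpose)
  have "(a, b) \<in> essential_set n w" "(a, b) \<noteq> (p, q)"
    using essential_reflected[OF assms] by auto
  then show "\<not> (w i < a \<and> a \<le> w j \<and> i \<le> b \<and> b < j)"
    using essential_in_rectangle[of a b] by blast
qed (use pivots_in left_simps right_simps in auto)

lemma perm_length_exchange: "perm_length n v = perm_length n w + 1"
proof (rule perm_length_transpose)
  fix b assume "i < b" "b < j"
  then show "w b < w i \<or> w j < w b"
    using left_column[of b] right_column[of b] by (cases "b \<le> q") auto
qed (use pivots_in left_simps right_simps in auto)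

lemma cond_exchange:
  assumes "(a, b) \<in> essential_set n v"
  shows cond_A_exchange: "cond_A n v a b \<longleftrightarrow> cond_A n w a b"
    and cond_B_exchange: "cond_B n v a b \<longleftrightarrow> cond_B n w a b"
proof -
  have "1 \<le> a" "a \<le> n + 1" "b \<le> n" using assms by (auto simp: essential_set_def diagram_def)
  then show "cond_A n v a b \<longleftrightarrow> cond_A n w a b" "cond_B n v a b \<longleftrightarrow> cond_B n w a b"
    by (simp_all add: cond_A_iff_rank cond_B_iff_rank[OF w] cond_B_iff_rank[OF v]
        rank_fun_exchange[OF assms])
qed

lemma essential_set''_exchange: "essential_set'' n v = essential_set'' n w - {(p, q)}"
proof (intro set_eqI, unfold split_paired_all)
  fix a b
  have "(a, b) \<in> essential_set n v \<longleftrightarrow> (a, b) \<in> essential_set n w \<and> (a, b) \<noteq> (p, q)"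
    by (simp add: essential_set_exchange)
  then show "(a, b) \<in> essential_set'' n v \<longleftrightarrow> (a, b) \<in> essential_set'' n w - {(p, q)}"
    unfolding essential_set''_def mem_Collect_eq prod.case Diff_iff singleton_iff
    using cond_exchange[of a b] by blast
qed

end

section \<open>Removable boxes\<close>

text \<open>
  Condition X is restated through a dot: given the other clauses of X, the box \<open>(p, q' - 1)\<close> lies in
  the diagram iff the dot of row \<open>p - 1\<close> is in column \<open>q' - 1\<close>.  In this form X is easily seen to
  survive an exchange, during which the dot may move to another column.
\<close>

definition left_removable :: "nat \<Rightarrow> (nat \<Rightarrow> nat) \<Rightarrow> nat \<Rightarrow> nat \<Rightarrow> bool" where
  "left_removable n w p q \<longleftrightarrow> cond_W n w p q \<or>
     (\<exists>p'<p. (p', q) \<in> essential_set n w \<and>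
        (\<forall>a<p. (a, q) \<in> essential_set n w \<longrightarrow> a = p') \<and>
        cond_B n w p' q \<and>
        rank_fun n w p' q = rank_fun n w p q + 1 \<and>
        (\<exists>c. 1 \<le> c \<and> c < q \<and> w c + 1 = p \<and> (\<forall>b. c < b \<and> b \<le> q \<longrightarrow> w b < p')))"

text \<open>Let \<open>m\<close> be the least column in X. The dot of column \<open>m - 1\<close>
  and the dot of row \<open>p - 1\<close> both lie in rows \<open>p'\<close> to \<open>p - 1\<close>
  and in the first \<open>q\<close> columns. The rank difference of one leaves room for a single dot
  there, so they coincide.\<close>

lemma left_removable_if_cond_X:
  assumes w: "w permutes {1..n}" and E: "(p, q) \<in> essential_set n w" and X: "cond_X n w p q"
  shows "left_removable n w p q"
proof -
  let ?P = "\<lambda>q' p'. \<forall>b\<in>{q'..q}. (p', b) \<in> diagram n w"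
  from X obtain p' where p': "p' < p" "(p', q) \<in> essential_set n w"
      "\<forall>a<p. (a, q) \<in> essential_set n w \<longrightarrow> a = p'" "cond_B n w p' q"
      "rank_fun n w p' q = rank_fun n w p q + 1"
      "(p, (LEAST q'. ?P q' p') - 1) \<in> diagram n w"
    unfolding cond_X_def by blast
  define m where "m = (LEAST q'. ?P q' p')"
  have D: "(p, q) \<in> diagram n w" "(p - 1, q) \<notin> diagram n w" "(p', q) \<in> diagram n w"
    using E p'(2) by (auto simp: essential_set_def)
  have m: "?P m p'"
    unfolding m_def by (rule LeastI[of _ q]) (use D in auto)
  have "m \<le> q"
    unfolding m_def by (rule Least_le) (use D in auto)
  have "(p, m - 1) \<in> diagram n w"
    using p'(6) by (simp only: m_def)
  then have c: "1 \<le> m - 1" "w (m - 1) < p" "m - 1 < inv w p"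
    by (auto simp: diagram_iff[OF w])
  have "\<not> ?P (m - 1) p'"
  proof
    assume "?P (m - 1) p'"
    then have "m \<le> m - 1" unfolding m_def by (rule Least_le)
    then show False using c by simp
  qed
  then obtain b where b: "m - 1 \<le> b" "b \<le> q" "(p', b) \<notin> diagram n w"
    by auto
  have "b = m - 1"
  proof (rule ccontr)
    assume "b \<noteq> m - 1"
    then have "b \<in> {m..q}" using b by simp
    then show False using m b(3) by blast
  qed
  moreover have "q < inv w p'" "w q < p'" "p' \<le> n" "1 \<le> q" "q \<le> n"
    using D(3) by (auto simp: diagram_def)
  ultimately have row: "p' \<le> w (m - 1)"
    using b c by (auto simp: diagram_iff[OF w])
  have pn: "p \<le> n" using D(1) by (simp add: diagram_def)
  have "inv w (p - 1) \<le> q"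
  proof (rule ccontr)
    assume "\<not> inv w (p - 1) \<le> q"
    moreover have "w q < p - 1" using \<open>w q < p'\<close> p'(1) by linarith
    ultimately have "(p - 1, q) \<in> diagram n w"
      using \<open>1 \<le> q\<close> pn by (simp add: diagram_iff[OF w])
    then show False using D(2) by contradiction
  qed
  moreover have "inv w (p - 1) \<in> {1..n}"
    using permutes_in_image[OF permutes_inv[OF w], of "p - 1"] pn p'(1) \<open>w q < p'\<close> by auto
  moreover have dot: "w (inv w (p - 1)) = p - 1"
    using permutes_inverses[OF w] by simp
  ultimately have "inv w (p - 1) \<in> {1..n}" "inv w (p - 1) \<le> q"
    "p' \<le> w (inv w (p - 1))" "w (inv w (p - 1)) < p"
    using p'(1) by simp_all
  moreover have "m - 1 < q" "m - 1 \<in> {1..n}" "m - 1 \<le> q"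
    using c(1) \<open>m \<le> q\<close> \<open>q \<le> n\<close> by auto
  ultimately have "inv w (p - 1) = m - 1"
    using rank_fun_Suc_row_unique[OF p'(5) less_imp_le[OF p'(1)]] row c(2) by blast
  then have "w (m - 1) + 1 = p"
    using dot p'(1) by simp
  moreover have "w b < p'" if "m - 1 < b" "b \<le> q" for b
  proof -
    have "b \<in> {m..q}" using that by simp
    then show ?thesis using m by (auto simp: diagram_def)
  qed
  ultimately show ?thesis
    unfolding left_removable_def using p'(1-5) c(1) \<open>m - 1 < q\<close> by blast
qed

text \<open>The topmost box of column \<open>q\<close>, if above row \<open>p\<close>, needs a right
  neighbour in order not to be essential, so the dot of column \<open>q + 1\<close> lies above row
  \<open>p\<close>. Since \<open>(p, q + 1)\<close> is not a box, the dot of row \<open>p\<close>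
  must then be in column \<open>q + 1\<close>, a contradiction.\<close>

lemma no_diagram_above_if_no_essential_above:
  assumes w: "w permutes {1..n}" and E: "(p, q) \<in> essential_set n w"
    and no: "\<And>a. a < p \<Longrightarrow> (a, q) \<notin> essential_set n w" and "a < p"
  shows "(a, q) \<notin> diagram n w"
  using \<open>a < p\<close>
proof (induction a)
  case 0
  then show ?case by (simp add: diagram_def)
next
  case (Suc a)
  show ?case
  proof
    assume D: "(Suc a, q) \<in> diagram n w"
    then have "(Suc a, q + 1) \<in> diagram n w"
      using Suc no[of "Suc a"] by (auto simp: essential_set_def)
    then have right: "w (q + 1) < Suc a" by (simp add: diagram_def)
    have "(p, q) \<in> diagram n w" "(p, q + 1) \<notin> diagram n w"
      using E by (auto simp: essential_set_def)
    then have "inv w p = q + 1"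
      using right Suc.prems by (auto simp: diagram_iff[OF w])
    then show False
      using right Suc.prems permutes_inv_eq[OF w, of p "q + 1"] by simp
  qed
qed

lemma left_pivot_if_left_removable:
  assumes w: "w permutes {1..n}" and E: "(p, q) \<in> essential_set n w" and L: "left_removable n w p q"
  shows "\<exists>i. left_pivot n w p q i"
proof -
  have D: "(p, q) \<in> diagram n w" "(p - 1, q) \<notin> diagram n w"
    using E by (auto simp: essential_set_def)
  then have box: "1 \<le> q" "q \<le> n" "p \<le> n" "w q < p" "q < inv w p"
    by (auto simp: diagram_def)
  have inv: "w (inv w a) = a" "inv w (w a) = a" for a
    using permutes_inverses[OF w] by auto
  consider (W) "cond_W n w p q" | (X) p' c where "p' < p" "(p', q) \<in> essential_set n w"
      "\<And>a. a < p \<Longrightarrow> (a, q) \<in> essential_set n w \<Longrightarrow> a = p'" "cond_B n w p' q"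
      "rank_fun n w p' q = rank_fun n w p q + 1"
      "1 \<le> c" "c < q" "w c + 1 = p" "\<And>b. c < b \<Longrightarrow> b \<le> q \<Longrightarrow> w b < p'"
    using L unfolding left_removable_def by blast
  then show ?thesis
  proof cases
    case W
    have above: "(a, q) \<notin> diagram n w" if "a < p" for a
      using no_diagram_above_if_no_essential_above[OF w E _ that] W by (simp add: cond_W_def)
    have row: "inv w a < q" if "w q < a" "a < p" for a
    proof -
      have "inv w a \<noteq> q" using inv(1)[of a] that by auto
      then show ?thesis
        using above[OF that(2)] that box by (auto simp: diagram_iff[OF w])
    qed
    \<comment> \<open>For a box \<open>(p, q - 1)\<close>, Condition W gives a rank equality that
      leaves no dot in rows \<open>p'\<close> to \<open>p - 1\<close> and columns before
      \<open>q\<close>. The dot of row \<open>p - 1\<close> would be there if \<open>w q\<close>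
      were smaller than \<open>p - 1\<close>.\<close>
    have "w q + 1 = p" if left_box: "(p, q - 1) \<in> diagram n w"
    proof (rule ccontr)
      assume "w q + 1 \<noteq> p"
      then have dot: "w q < p - 1" "p - 1 < p" using box by auto
      obtain p' where p': "p' < p" "rank_fun n w p' (q - 1) = rank_fun n w p q"
        using W left_box by (auto simp: cond_W_def)
      have "q - 1 + 1 = q" using box by simp
      then have "rank_fun n w p q = rank_fun n w p (q - 1)"
        using rank_fun_step_column[of "q - 1" n w p] box by simp
      with p' have rank: "rank_fun n w p' (q - 1) = rank_fun n w p (q - 1)" by simp
      have "inv w (p - 1) \<in> {1..n}"
        using permutes_in_image[OF permutes_inv[OF w], of "p - 1"] dot box by auto
      then have "p \<le> w (inv w (p - 1))"
        using rank_fun_eqD[OF rank, of "inv w (p - 1)"] row[OF dot] p'(1) by (simp add: inv)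
      then show False using dot by (simp add: inv)
    qed
    then have "left_pivot n w p q q"
      using box row by (auto simp: left_pivot_def)
    then show ?thesis by blast
  next
    case X
    have p': "q < inv w p'" "w q < p'" "p' \<noteq> p - 1"
      using X(2) D(2) by (auto simp: essential_set_def diagram_def)
    \<comment> \<open>Within the first \<open>q\<close> columns, the dot of row \<open>p - 2\<close>
      would be a second one in rows \<open>p'\<close> to \<open>p - 1\<close>, besides that of
      column \<open>c\<close>.\<close>
    have "q < inv w (p - 2)"
    proof (rule ccontr)
      assume "\<not> q < inv w (p - 2)"
      moreover have "p - 2 \<in> {1..n}" "p' \<le> p - 2" using p' X(1,8) box by auto
      moreover from this have "inv w (p - 2) \<in> {1..n}"
        using permutes_in_image[OF permutes_inv[OF w], of "p - 2"] by simp
      ultimately have "inv w (p - 2) = c"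
        using rank_fun_Suc_row_unique[OF X(5) less_imp_le[OF X(1)], of "inv w (p - 2)" c]
          X(1,6-8) box by (simp add: inv)
      then have "w c = p - 2" using inv(1) by auto
      then show False using X(1,8) p'(2) by linarith
    qed
    then have "(p - 2, q) \<in> diagram n w"
      using box p' X(1) by (auto simp: diagram_iff[OF w])
    moreover have "w b < w c" if "c < b" "b \<le> q" for b
      using X(9)[OF that] X(1,8) by simp
    moreover have "cond_B n w a q" if "a < p" "(a, q) \<in> essential_set n w" for a
      using X(3)[OF that] X(4) by simp
    ultimately have "left_pivot n w p q c"
      using X(6-8) by (auto simp: left_pivot_def)
    then show ?thesis by blast
  qed
qed

section \<open>Removability of the remaining boxes, left side\<close>

context exchange
begin

lemma essential_exchange_iff:
  "(a, b) \<in> essential_set n v \<longleftrightarrow> (a, b) \<in> essential_set n w \<and> (a, b) \<noteq> (p, q)"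
  by (simp add: essential_set_exchange)

text \<open>A newly created box immediately left of \<open>(a, b)\<close> would have to lie in
  column \<open>j\<close>. In row \<open>p\<close>, the right pivot then gives Condition B for
  \<open>(a, b)\<close>, which is excluded in \<open>essential_set''\<close>; in a lower row there
  would be a box above \<open>(a, b)\<close>.\<close>

lemma diagram_left_neighbour:
  assumes ab: "(a, b) \<in> essential_set'' n w" "(a, b) \<noteq> (p, q)"
    and "(a, b - 1) \<notin> diagram n w"
  shows "(a, b - 1) \<notin> diagram n v"
proof
  have E: "(a, b) \<in> essential_set n w" "\<not> cond_B n w a b"
    using ab by (auto simp: essential_set''_def)
  then have D: "(a, b) \<in> diagram n w" "(a - 1, b) \<notin> diagram n w"
    by (auto simp: essential_set_def)
  then have dots: "b < inv w a" "w b < a" "1 \<le> b" "a \<le> n" by (auto simp: diagram_def)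
  assume "(a, b - 1) \<in> diagram n v"
  then consider "i < b - 1" "a = w i" | "i < b - 1" "b - 1 \<le> q" "p \<le> a" "a < w j"
    | "b - 1 = j" "p \<le> a" "a < w j"
    using assms(3) diagram_exchange by blast
  then show False
  proof cases
    case 1
    then show ?thesis using dots by (simp add: inv_w)
  next
    case 2
    then show ?thesis using corner_subset_diagram[of a "b - 1"] assms(3) by simp
  next
    case 3
    then have j: "j = q + 1" "(p, q + 2) \<in> diagram n w" and b: "b = q + 2" "q < b"
      using right_strict(1,2) by auto
    show ?thesis
    proof (cases "a = p")
      case True
      then show ?thesis using right_strict(3)[of b] 3 E b by simp
    next
      case False
      then have "j < inv w (a - 1)" "w b < p" using right_row[of "a - 1"] 3 j(2) b
        by (auto simp: diagram_def)
      moreover have "inv w (a - 1) \<noteq> b"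
        using \<open>w b < p\<close> False 3 by (auto simp: inv_eq_iff)
      ultimately have "(a - 1, b) \<in> diagram n w"
        using 3 False dots b j by (auto simp: diagram_iff[OF w])
      then show ?thesis using D(2) by contradiction
    qed
  qed
qed

text \<open>The witness in W satisfies B and so is not the removed box; it survives with its
  rank.\<close>

lemma cond_W_exchange:
  assumes ab: "(a, b) \<in> essential_set'' n w" "(a, b) \<noteq> (p, q)"
    and x: "(p, q) \<in> essential_set'' n w" and W: "cond_W n w a b"
  shows "cond_W n v a b"
proof -
  have E: "(a, b) \<in> essential_set n v" and B: "\<not> cond_B n w p q"
    using ab x by (auto simp: essential_set''_def essential_exchange_iff)
  have "(a, b - 1) \<notin> diagram n v" if "(a, b - 1) \<notin> diagram n w"
    by (rule diagram_left_neighbour[OF ab that])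
  moreover have "\<exists>p'<a. (p', b - 1) \<in> essential_set n v \<and> cond_B n v p' (b - 1) \<and>
      rank_fun n v p' (b - 1) = rank_fun n v a b"
    if p': "p' < a" "(p', b - 1) \<in> essential_set n w" "cond_B n w p' (b - 1)"
      "rank_fun n w p' (b - 1) = rank_fun n w a b" for p'
  proof -
    have "(p', b - 1) \<in> essential_set n v"
      using p' B by (auto simp: essential_exchange_iff)
    then show ?thesis
      using p' E by (auto simp: cond_B_exchange rank_fun_exchange)
  qed
  moreover have "\<forall>p'<a. (p', b) \<notin> essential_set n v"
    using W by (auto simp: cond_W_def essential_exchange_iff)
  ultimately show ?thesis
    using W unfolding cond_W_def by blast
qed

text \<open>Outside W, the box \<open>(p', b)\<close> survives because it satisfies B. What needs
  tracking is the dot of row \<open>a - 1\<close>: it moves to column \<open>i\<close> if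
  \<open>c = j\<close>, cannot be in column \<open>i\<close>, and otherwise stays in place.\<close>

lemma left_removable_exchange:
  assumes ab: "(a, b) \<in> essential_set'' n w" "(a, b) \<noteq> (p, q)"
    and x: "(p, q) \<in> essential_set'' n w" and L: "left_removable n w a b"
  shows "left_removable n v a b"
proof (cases "cond_W n w a b")
  case True
  then show ?thesis
    using cond_W_exchange[OF ab x] by (simp add: left_removable_def)
next
  case False
  then obtain p' c where p': "p' < a" "(p', b) \<in> essential_set n w"
      "\<And>l. l < a \<Longrightarrow> (l, b) \<in> essential_set n w \<Longrightarrow> l = p'" "cond_B n w p' b"
      "rank_fun n w p' b = rank_fun n w a b + 1"
      and c: "1 \<le> c" "c < b" "w c + 1 = a" "\<And>l. c < l \<Longrightarrow> l \<le> b \<Longrightarrow> w l < p'"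
    using L unfolding left_removable_def by blast
  have E: "(a, b) \<in> essential_set n w" "(a, b) \<in> essential_set n v" and B: "\<not> cond_B n w p q"
    using ab x by (auto simp: essential_set''_def essential_exchange_iff)
  then have D: "w b < a" "b < inv w a" "a \<le> n" "b \<le> n" by (auto simp: essential_set_def diagram_def)
  have E': "(p', b) \<in> essential_set n v"
    using p'(2,4) B by (auto simp: essential_exchange_iff)
  have outside: "\<not> (w i < p' \<and> p' \<le> w j \<and> i \<le> b \<and> b < j)" "\<not> (w i < a \<and> a \<le> w j \<and> i \<le> b \<and> b < j)"
    using essential_in_rectangle[OF p'(2)] essential_in_rectangle[OF E(1)] ab(2) E'
    by (auto simp: essential_exchange_iff)
  have "\<exists>c. 1 \<le> c \<and> c < b \<and> v c + 1 = a \<and> (\<forall>l. c < l \<and> l \<le> b \<longrightarrow> v l < p')"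
  proof -
    consider "c = j" | "c = i" | "c \<noteq> i" "c \<noteq> j" by blast
    then show ?thesis
    proof cases
      case 1
      then have a: "a = w j + 1" using c by simp
      then have "(w j + 1, q) \<in> diagram n w"
        using D c 1 left_simps right_simps left_column[of q] box_bounds
        by (cases "i = q") (auto simp: diagram_iff[OF w])
      then have j: "j = q + 1" by (rule right_diagram)
      \<comment> \<open>Otherwise both exchanged dots would lie in rows \<open>p'\<close> to
        \<open>a - 1\<close> within the first \<open>b\<close> columns, where the ranks allow only
        one.\<close>
      have "w i < p'"
      proof (rule ccontr)
        assume "\<not> w i < p'"
        then have "i = j"
          using rank_fun_Suc_row_unique[OF p'(5) less_imp_le[OF p'(1)], of i j]
            pivots_in left_simps right_simps c(2) 1 a p'(1) by simp
        then show False using left_simps right_simps by simp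
      qed
      have "v l < p'" if "i < l" "l \<le> b" for l
      proof -
        consider "l < j" | "l = j" | "j < l" by linarith
        then show ?thesis
        proof cases
          case 1
          then show ?thesis
            using that j left_column[of l] \<open>w i < p'\<close> v_simps(3)[of l] by simp
        next
          case 2
          then show ?thesis using \<open>w i < p'\<close> by simp
        next
          case 3
          then show ?thesis
            using that 1 c(4)[of l] v_simps(3)[of l] by simp
        qed
      qed
      then show ?thesis
        using 1 c left_simps right_simps by (intro exI[of _ i]) auto
    next
      case 2
      then have "a \<le> w j" using c left_simps right_simps by simp
      \<comment> \<open>The essential box \<open>(a, b)\<close> avoids the rectangle of changed
        ranks, so column \<open>j\<close> is among those whose dots lie above row
        \<open>p'\<close>.\<close>
      then have "j \<le> b" using outside(2) 2 c by auto
      then have "w j < p'" using c(4)[of j] 2 left_simps right_simps by simp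
      then show ?thesis using \<open>a \<le> w j\<close> p'(1) by simp
    next
      case 3
      have "v l < p'" if l: "c < l" "l \<le> b" for l
      proof -
        consider "l = i" | "l = j" | "l \<noteq> i" "l \<noteq> j" by blast
        then show ?thesis
        proof cases
          case 1
          have "w j < p'"
          proof (cases "b < j")
            case True
            then show ?thesis using outside(1) c(4)[OF l] l 1 by auto
          next
            case False
            then show ?thesis using c(4)[of j] l 1 left_simps right_simps by simp
          qed
          then show ?thesis using 1 by simp
        next
          case 2
          then show ?thesis using c(4)[OF l] left_simps right_simps by simp
        next
          case 3
          then show ?thesis using c(4)[OF l] by simp
        qed
      qed
      then show ?thesis
        using 3 c by (intro exI[of _ c]) auto
    qed
  qed
  moreover have "\<forall>l<a. (l, b) \<in> essential_set n v \<longrightarrow> l = p'"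
    using p'(3) by (auto simp: essential_exchange_iff)
  moreover have "cond_B n v p' b" "rank_fun n v p' b = rank_fun n v a b + 1"
    using p'(4,5) E' E(2) by (simp_all add: cond_B_exchange rank_fun_exchange)
  ultimately show ?thesis
    unfolding left_removable_def using p'(1) E' by blast
qed

end

section \<open>Reflecting the conditions on the right\<close>

lemma right_pivot_antitranspose_iff:
  assumes w: "w permutes {1..n}" and pq: "p \<in> {1..n}" "q \<in> {1..n}" and j: "j \<in> {1..n}"
  shows "right_pivot n w p q j \<longleftrightarrow>
    left_pivot n (antitranspose n w) (n + 1 - q) (n + 1 - p) (n + 1 - w j)"
\<comment> \<open>The guard makes identities such as \<open>n + 1 - (P - 2) = q + 2\<close> hold
  under truncated subtraction; without it both sides fail. Under the reflection, column clauses
  become row clauses and conversely.\<close>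
proof (cases "q < j \<and> p \<le> w j")
  case True
  let ?w = "antitranspose n w"
  define P Q I where PQ: "P = n + 1 - q" "Q = n + 1 - p" "I = n + 1 - w j"
  have in_range: "w a \<in> {1..n}" "inv w a \<in> {1..n}" if "a \<in> {1..n}" for a
    using that permutes_in_image[OF w, of a] permutes_in_image[OF permutes_inv[OF w], of a] by auto
  have bounds: "1 \<le> w j" "w j \<le> n" using in_range(1)[OF j] by auto
  have w_apply: "?w (n + 1 - a) = n + 1 - inv w a" if "a \<in> {1..n}" for a
    using that by (auto simp: antitranspose_def)
  have inv_apply: "inv ?w (n + 1 - a) = n + 1 - w a" if "a \<in> {1..n}" for a
    using that permutes_inv_inv[OF w] by (auto simp: inv_antitranspose[OF w] antitranspose_def)
  have wI: "?w I = n + 1 - j"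
    using w_apply[of "w j"] in_range(1)[OF j] permutes_inverses(2)[OF w] by (simp add: PQ)
  have column: "(\<forall>b. I < b \<and> b \<le> Q \<longrightarrow> ?w b < ?w I) \<longleftrightarrow> (\<forall>a. p \<le> a \<and> a < w j \<longrightarrow> j < inv w a)"
  proof (intro iffI allI impI)
    fix a assume H: "\<forall>b. I < b \<and> b \<le> Q \<longrightarrow> ?w b < ?w I" and a: "p \<le> a \<and> a < w j"
    then have "I < n + 1 - a" "n + 1 - a \<le> Q" "a \<in> {1..n}"
      using bounds pq by (auto simp: PQ)
    then have "?w (n + 1 - a) < ?w I" using H by blast
    then have "n + 1 - inv w a < n + 1 - j"
      unfolding wI w_apply[OF \<open>a \<in> {1..n}\<close>] .
    then show "j < inv w a" by linarith
  next
    fix b assume H: "\<forall>a. p \<le> a \<and> a < w j \<longrightarrow> j < inv w a" and b: "I < b \<and> b \<le> Q"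
    then have "p \<le> n + 1 - b" "n + 1 - b < w j" and b': "n + 1 - b \<in> {1..n}" "n + 1 - (n + 1 - b) = b"
      using bounds pq by (auto simp: PQ)
    then have "j < inv w (n + 1 - b)" using H by blast
    then show "?w b < ?w I"
      using w_apply[OF b'(1)] in_range(2)[OF b'(1)] unfolding wI b'(2) by auto
  qed
  have row: "(\<forall>a. ?w I < a \<and> a < P \<longrightarrow> inv ?w a < I) \<longleftrightarrow> (\<forall>b. q < b \<and> b < j \<longrightarrow> w j < w b)"
  proof (intro iffI allI impI)
    fix b assume H: "\<forall>a. ?w I < a \<and> a < P \<longrightarrow> inv ?w a < I" and b: "q < b \<and> b < j"
    then have "?w I < n + 1 - b" "n + 1 - b < P" "b \<in> {1..n}"
      unfolding wI unfolding PQ using j by auto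
    then have "inv ?w (n + 1 - b) < I" using H by blast
    then have "n + 1 - w b < n + 1 - w j"
      unfolding PQ(3) inv_apply[OF \<open>b \<in> {1..n}\<close>] .
    then show "w j < w b" by linarith
  next
    fix a assume H: "\<forall>b. q < b \<and> b < j \<longrightarrow> w j < w b" and a: "?w I < a \<and> a < P"
    then have "q < n + 1 - a" "n + 1 - a < j" and a': "n + 1 - a \<in> {1..n}" "n + 1 - (n + 1 - a) = a"
      unfolding wI unfolding PQ using j by auto
    then have "w j < w (n + 1 - a)" using H by blast
    then show "inv ?w a < I"
      using inv_apply[OF a'(1)] in_range(1)[OF a'(1)] unfolding PQ a'(2) by auto
  qed
  have diag: "(P, I - 1) \<in> diagram n ?w \<longleftrightarrow> (w j + 1, q) \<in> diagram n w"
    "(P - 2, Q) \<in> diagram n ?w \<longleftrightarrow> (p, q + 2) \<in> diagram n w"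
  proof -
    have "n + 1 - (I - 1) = w j + 1" "n + 1 - P = q" "n + 1 - (P - 2) = q + 2" "n + 1 - Q = p"
      using bounds pq True j by (auto simp: PQ)
    moreover have "P \<le> n + 1" "I - 1 \<le> n + 1" "P - 2 \<le> n + 1" "Q \<le> n + 1"
      by (auto simp: PQ)
    ultimately show "(P, I - 1) \<in> diagram n ?w \<longleftrightarrow> (w j + 1, q) \<in> diagram n w"
      "(P - 2, Q) \<in> diagram n ?w \<longleftrightarrow> (p, q + 2) \<in> diagram n w"
      by (simp_all add: diagram_antitranspose[OF w])
  qed
  have ess: "(\<forall>a<P. (a, Q) \<in> essential_set n ?w \<longrightarrow> cond_B n ?w a Q) \<longleftrightarrow>
      (\<forall>b>q. (p, b) \<in> essential_set n w \<longrightarrow> cond_B n w p b)"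
  proof (intro iffI allI impI)
    fix b assume H: "\<forall>a<P. (a, Q) \<in> essential_set n ?w \<longrightarrow> cond_B n ?w a Q"
      and b: "q < b" "(p, b) \<in> essential_set n w"
    then have b': "b \<in> {1..n}" by (auto simp: essential_set_def diagram_def)
    then have arith: "n + 1 - Q = p" "n + 1 - (n + 1 - b) = b" "n + 1 - b < P"
      using pq b(1) by (auto simp: PQ)
    then have "(n + 1 - b, Q) \<in> essential_set n ?w"
      using b(2) by (subst essential_set_antitranspose[OF w]) (auto simp: PQ)
    then have "cond_B n ?w (n + 1 - b) Q" using H arith(3) by blast
    then have "cond_B n w (n + 1 - Q) (n + 1 - (n + 1 - b))"
      using b' pq by (subst (asm) cond_B_antitranspose[OF w]) (auto simp: PQ)
    then show "cond_B n w p b" unfolding arith .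
  next
    fix a assume H: "\<forall>b>q. (p, b) \<in> essential_set n w \<longrightarrow> cond_B n w p b"
      and a: "a < P" "(a, Q) \<in> essential_set n ?w"
    then have a': "a \<in> {1..n}" by (auto simp: essential_set_def diagram_def)
    then have arith: "n + 1 - Q = p" "q < n + 1 - a"
      using pq a(1) by (auto simp: PQ)
    have "(n + 1 - Q, n + 1 - a) \<in> essential_set n w"
      using a(2) a' by (subst (asm) essential_set_antitranspose[OF w]) (auto simp: PQ)
    then have "cond_B n w (n + 1 - Q) (n + 1 - a)" using H arith by simp
    then show "cond_B n ?w a Q"
      using a' pq by (subst cond_B_antitranspose[OF w]) (auto simp: PQ)
  qed
  have "1 \<le> I" "I \<le> Q" "?w I < P" "I < Q \<longleftrightarrow> p < w j" "?w I + 1 = P \<longleftrightarrow> j = q + 1"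
    using True bounds pq j unfolding wI by (auto simp: PQ)
  then show ?thesis
    using True j unfolding PQ[symmetric] left_pivot_def right_pivot_def column row diag ess
    by auto
next
  case False
  have "w j \<in> {1..n}" using permutes_in_image[OF w, of j] j by simp
  then have eq: "antitranspose n w (n + 1 - w j) = n + 1 - j"
    using permutes_inverses(2)[OF w] by (auto simp: antitranspose_def)
  have "\<not> (n + 1 - w j \<le> n + 1 - p \<and> n + 1 - j < n + 1 - q)"
    using False pq j \<open>w j \<in> {1..n}\<close> by auto
  then have "\<not> left_pivot n (antitranspose n w) (n + 1 - q) (n + 1 - p) (n + 1 - w j)"
    unfolding left_pivot_def eq by blast
  moreover have "\<not> right_pivot n w p q j"
    using False unfolding right_pivot_def by blast
  ultimately show ?thesis by blast
qed

lemma essential_set''_antitranspose: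
  assumes w: "w permutes {1..n}" and ab: "(a, b) \<in> essential_set'' n w"
  shows "(n + 1 - b, n + 1 - a) \<in> essential_set'' n (antitranspose n w)"
proof -
  have "(a, b) \<in> essential_set n w" and nAB: "\<not> cond_A n w a b" "\<not> cond_B n w a b"
    using ab by (auto simp: essential_set''_def)
  moreover from this have bounds: "a \<in> {1..n}" "b \<in> {1..n}"
    by (auto simp: essential_set_def diagram_def)
  then have arith: "n + 1 - (n + 1 - a) = a" "n + 1 - (n + 1 - b) = b"
    "1 \<le> n + 1 - b" "n + 1 - b \<le> n + 1" "n + 1 - a \<le> n" "n + 1 - a \<le> n + 1" by auto
  ultimately have "(n + 1 - b, n + 1 - a) \<in> essential_set n (antitranspose n w)"
    by (simp only: essential_set_antitranspose[OF w] arith)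
  moreover have "\<not> cond_A n (antitranspose n w) (n + 1 - b) (n + 1 - a)"
    using nAB(1) rank_fun_antitranspose[OF w arith(3-5)] unfolding cond_A_iff_rank arith by simp
  moreover have "\<not> cond_B n (antitranspose n w) (n + 1 - b) (n + 1 - a)"
    using nAB(2) cond_B_antitranspose[OF w arith(3-5)] unfolding arith by simp
  ultimately show ?thesis unfolding essential_set''_def mem_Collect_eq prod.case by blast
qed

text \<open>Each clause of Y reflects to a clause of W, row \<open>p + 1\<close> becoming column
  \<open>n + 1 - p - 1\<close>.\<close>

lemma left_removable_antitranspose_if_cond_Y:
  assumes w: "w permutes {1..n}" and E: "(p, q) \<in> essential_set n w" and Y: "cond_Y n w p q"
  shows "left_removable n (antitranspose n w) (n + 1 - q) (n + 1 - p)"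
proof -
  let ?w = "antitranspose n w"
  have pq: "1 \<le> p" "p \<le> n" "1 \<le> q" "q \<le> n" using E by (auto simp: essential_set_def diagram_def)
  have no_right: "\<And>b. q < b \<Longrightarrow> (p, b) \<notin> essential_set n w"
    using Y by (auto simp: cond_Y_def)
  have "(a, n + 1 - p) \<notin> essential_set n ?w" if "a < n + 1 - q" for a
    using no_right[of "n + 1 - a"] that pq by (subst essential_set_antitranspose[OF w]) auto
  moreover have "(n + 1 - q, n + 1 - p - 1) \<notin> diagram n ?w" if "(p + 1, q) \<notin> diagram n w"
    using that pq by (subst diagram_antitranspose[OF w]) auto
  moreover have "\<exists>p'<n + 1 - q. (p', n + 1 - p - 1) \<in> essential_set n ?w \<and>
      cond_B n ?w p' (n + 1 - p - 1) \<and>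
      rank_fun n ?w p' (n + 1 - p - 1) = rank_fun n ?w (n + 1 - q) (n + 1 - p)"
    if q': "q < q'" "(p + 1, q') \<in> essential_set n w" "cond_B n w (p + 1) q'"
      "rank_fun n w (p + 1) q' = rank_fun n w p q" for q'
  proof (intro exI[of _ "n + 1 - q'"] conjI)
    have q'n: "q' \<le> n" "p + 1 \<le> n" using q'(2) by (auto simp: essential_set_def diagram_def)
    then have arith: "n + 1 - (n + 1 - p - 1) = p + 1" "n + 1 - (n + 1 - q') = q'"
      "n + 1 - (n + 1 - p) = p" "n + 1 - (n + 1 - q) = q"
      "1 \<le> n + 1 - q'" "n + 1 - q' \<le> n + 1" "n + 1 - p - 1 \<le> n" "n + 1 - p - 1 \<le> n + 1"
      "1 \<le> n + 1 - q" "n + 1 - q \<le> n + 1" "n + 1 - p \<le> n"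
      using pq by auto
    show "n + 1 - q' < n + 1 - q" using q'(1) q'n by simp
    show "(n + 1 - q', n + 1 - p - 1) \<in> essential_set n ?w"
      using q'(2) by (simp only: essential_set_antitranspose[OF w] arith)
    show "cond_B n ?w (n + 1 - q') (n + 1 - p - 1)"
      using q'(3) by (simp only: cond_B_antitranspose[OF w] arith)
    show "rank_fun n ?w (n + 1 - q') (n + 1 - p - 1) = rank_fun n ?w (n + 1 - q) (n + 1 - p)"
      using q'(4) by (simp only: rank_fun_antitranspose[OF w] arith)
  qed
  ultimately have "cond_W n ?w (n + 1 - q) (n + 1 - p)"
    using Y unfolding cond_W_def cond_Y_def by blast
  then show ?thesis by (simp add: left_removable_def)
qed

text \<open>Z is translated directly into the dot form of X: if \<open>m\<close> is the greatest row
  in Z, the dot of row \<open>m + 1\<close> is in column \<open>q + 1\<close>, and its reflection is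
  the required dot.\<close>

lemma left_removable_antitranspose_if_cond_Z:
  assumes w: "w permutes {1..n}" and E: "(p, q) \<in> essential_set n w" and Z: "cond_Z n w p q"
  shows "left_removable n (antitranspose n w) (n + 1 - q) (n + 1 - p)"
proof -
  let ?w = "antitranspose n w"
  let ?P = "\<lambda>p' q'. \<forall>a\<in>{p..p'}. (a, q') \<in> diagram n w"
  from Z obtain q' where q': "q < q'" "(p, q') \<in> essential_set n w"
      "\<forall>b>q. (p, b) \<in> essential_set n w \<longrightarrow> b = q'" "cond_B n w p q'"
      "rank_fun n w p q' = rank_fun n w p q + 1"
      "((GREATEST p'. ?P p' q') + 1, q) \<in> diagram n w"
    unfolding cond_Z_def by blast
  define m where "m = (GREATEST p'. ?P p' q')"
  have D: "(p, q + 1) \<notin> diagram n w" "(p, q') \<in> diagram n w" "(p, q) \<in> diagram n w"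
    using E q'(2) by (auto simp: essential_set_def)
  then have box: "1 \<le> p" "p \<le> n" "1 \<le> q" "q' \<le> n" "w q' < p" "q' < inv w p"
    by (auto simp: diagram_def)
  have bound: "p' \<le> n" if "?P p' q'" for p'
  proof (rule ccontr)
    assume "\<not> p' \<le> n"
    then have "(p', q') \<in> diagram n w" using that box by auto
    then show False using \<open>\<not> p' \<le> n\<close> by (simp add: diagram_def)
  qed
  have Pp: "?P p q'" using D(2) by simp
  have m: "?P m q'"
    unfolding m_def by (rule GreatestI_nat[of "\<lambda>p'. ?P p' q'", OF Pp bound])
  have "p \<le> m"
    unfolding m_def by (rule Greatest_le_nat[of "\<lambda>p'. ?P p' q'", OF Pp bound])
  have "(m + 1, q) \<in> diagram n w"
    using q'(6) by (simp only: m_def)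
  then have d: "m + 1 \<le> n" "q < inv w (m + 1)"
    by (auto simp: diagram_def)
  have "\<not> ?P (m + 1) q'"
  proof
    assume "?P (m + 1) q'"
    then have "m + 1 \<le> m" unfolding m_def by (rule Greatest_le_nat[of "\<lambda>p'. ?P p' q'", OF _ bound])
    then show False by simp
  qed
  then have "(m + 1, q') \<notin> diagram n w"
    using m by (auto simp: le_Suc_eq)
  then have "inv w (m + 1) \<le> q'"
    using box d \<open>p \<le> m\<close> q'(1) by (auto simp: diagram_iff[OF w])
  have "p \<le> w (q + 1)"
    using D(1) box q'(1) by (auto simp: diagram_iff[OF w])
  \<comment> \<open>The dots of row \<open>m + 1\<close> and of column \<open>q + 1\<close> both lie
    in columns \<open>q + 1\<close> to \<open>q'\<close> and weakly below row \<open>p\<close>,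
    where the ranks allow only one.\<close>
  have dot: "inv w (m + 1) = q + 1"
    using rank_fun_Suc_unique[OF q'(5) order_refl less_imp_le[OF q'(1)], of "inv w (m + 1)" "q + 1"]
      d \<open>inv w (m + 1) \<le> q'\<close> \<open>p \<le> m\<close> \<open>p \<le> w (q + 1)\<close> q'(1) box permutes_inverses(1)[OF w]
    by simp
  have arith: "n + 1 - (n + 1 - q') = q'" "n + 1 - (n + 1 - p) = p" "n + 1 - (n + 1 - q) = q"
    "1 \<le> n + 1 - q'" "n + 1 - q' \<le> n + 1" "n + 1 - p \<le> n" "n + 1 - p \<le> n + 1"
    "1 \<le> n + 1 - q" "n + 1 - q \<le> n + 1"
    using box q'(1) by auto
  have w_apply: "?w a = n + 1 - inv w (n + 1 - a)" if "a \<in> {1..n}" for a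
    using that by (auto simp: antitranspose_def)
  have c: "\<exists>c. 1 \<le> c \<and> c < n + 1 - p \<and> ?w c + 1 = n + 1 - q \<and>
      (\<forall>b. c < b \<and> b \<le> n + 1 - p \<longrightarrow> ?w b < n + 1 - q')"
  \<comment> \<open>\<open>n - m\<close> is \<open>n + 1 - (m + 1)\<close>, the column of the
    reflected dot.\<close>
  proof (intro exI[of _ "n - m"] conjI allI impI)
    show "1 \<le> n - m" "n - m < n + 1 - p" using d \<open>p \<le> m\<close> by auto
    have "n - m \<in> {1..n}" "n + 1 - (n - m) = m + 1" using d \<open>p \<le> m\<close> box by auto
    then show "?w (n - m) + 1 = n + 1 - q"
      using w_apply[of "n - m"] dot box q'(1) by simp
  next
    fix b assume b: "n - m < b \<and> b \<le> n + 1 - p"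
    then have "n + 1 - b \<in> {p..m}" and b': "b \<in> {1..n}"
      using box by auto
    then have "(n + 1 - b, q') \<in> diagram n w" using m by blast
    then have "q' < inv w (n + 1 - b)" by (simp add: diagram_def)
    then show "?w b < n + 1 - q'"
      unfolding w_apply[OF b'] using box by linarith
  qed
  have unique: "a = n + 1 - q'"
    if a: "a < n + 1 - q" "(a, n + 1 - p) \<in> essential_set n ?w" for a
  proof -
    have an: "a \<in> {1..n}" "a \<le> n + 1" using a(2) by (auto simp: essential_set_def diagram_def)
    have "(p, n + 1 - a) \<in> essential_set n w"
      using essential_set_antitranspose[OF w an(2) arith(7)] a(2) unfolding arith by simp
    moreover have "q < n + 1 - a" using a(1) by linarith
    ultimately have "n + 1 - a = q'" using q'(3) by blast
    then show ?thesis using an by auto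
  qed
  have "n + 1 - q' < n + 1 - q"
    using q'(1) box by simp
  moreover have "(n + 1 - q', n + 1 - p) \<in> essential_set n ?w"
    using essential_set_antitranspose[OF w arith(5,7)] q'(2) unfolding arith by simp
  moreover have "cond_B n ?w (n + 1 - q') (n + 1 - p)"
    using cond_B_antitranspose[OF w arith(4-6)] q'(4) unfolding arith by simp
  moreover have "rank_fun n ?w (n + 1 - q') (n + 1 - p) = rank_fun n ?w (n + 1 - q) (n + 1 - p) + 1"
    using rank_fun_antitranspose[OF w arith(4-6)] rank_fun_antitranspose[OF w arith(8,9,6)] q'(5)
    unfolding arith by simp
  ultimately show ?thesis
    unfolding left_removable_def using c unique by blast
qed

text \<open>
  The conditions on the right of a box are those on its left for the permutation reflected in the
  antidiagonal, which exchanges W with Y and X with Z.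
\<close>

definition removable :: "nat \<Rightarrow> (nat \<Rightarrow> nat) \<Rightarrow> nat \<Rightarrow> nat \<Rightarrow> bool" where
  "removable n w p q \<longleftrightarrow>
     left_removable n w p q \<and> left_removable n (antitranspose n w) (n + 1 - q) (n + 1 - p)"

section \<open>Removing all boxes, and the resulting permutation\<close>

lemma removable_if_almost_defined_by_inclusions:
  assumes w: "w permutes {1..n}" and "almost_defined_by_inclusions n w"
    and "(p, q) \<in> essential_set'' n w"
  shows "removable n w p q"
proof -
  have E: "(p, q) \<in> essential_set n w"
    and "cond_W n w p q \<or> cond_X n w p q" "cond_Y n w p q \<or> cond_Z n w p q"
    using assms(2,3) by (auto simp: almost_defined_by_inclusions_def essential_set''_def)
  then show ?thesis
    using left_removable_if_cond_X[OF w E] left_removable_antitranspose_if_cond_Y[OF w E]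
      left_removable_antitranspose_if_cond_Z[OF w E]
    by (auto simp: removable_def left_removable_def[of n w])
qed

text \<open>The exchange in \<open>w\<close> and the reflected exchange in its antitranspose are two
  instances of one construction, and reflection carries the result of the first to that of the
  second. Survival of the left condition, applied to both, yields both halves of
  \<open>removable\<close>.\<close>

lemma remove_box:
  assumes w: "w permutes {1..n}"
    and R: "\<And>a b. (a, b) \<in> essential_set'' n w \<Longrightarrow> removable n w a b"
    and x: "(p, q) \<in> essential_set'' n w"
  obtains v where "v permutes {1..n}"
    "essential_set n v = essential_set n w - {(p, q)}"
    "essential_set'' n v = essential_set'' n w - {(p, q)}"
    "\<And>a b. (a, b) \<in> essential_set n v \<Longrightarrow> rank_fun n v a b = rank_fun n w a b"
    "perm_length n v = perm_length n w + 1"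
    "\<And>a b. (a, b) \<in> essential_set'' n v \<Longrightarrow> removable n v a b"
proof -
  let ?w = "antitranspose n w"
  have E: "(p, q) \<in> essential_set n w" using x by (simp add: essential_set''_def)
  then have pq: "p \<in> {1..n}" "q \<in> {1..n}" by (auto simp: essential_set_def diagram_def)
  then have arith: "n + 1 - (n + 1 - p) = p" "n + 1 - (n + 1 - q) = q"
    "n + 1 - p \<in> {1..n}" "n + 1 - q \<in> {1..n}" by auto
  have w': "?w permutes {1..n}" by (rule antitranspose_permutes[OF w])
  have x': "(n + 1 - q, n + 1 - p) \<in> essential_set'' n ?w"
    by (rule essential_set''_antitranspose[OF w x])
  then have E': "(n + 1 - q, n + 1 - p) \<in> essential_set n ?w"
    by (simp add: essential_set''_def)
  obtain i where i: "left_pivot n w p q i"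
    using left_pivot_if_left_removable[OF w E] R[OF x] by (auto simp: removable_def)
  obtain k where k: "left_pivot n ?w (n + 1 - q) (n + 1 - p) k"
    using left_pivot_if_left_removable[OF w' E'] R[OF x] by (auto simp: removable_def)
  \<comment> \<open>\<open>k\<close> is the column of the reflected dot, so the dot itself is in row
    \<open>n + 1 - k\<close>.\<close>
  define j where "j = inv w (n + 1 - k)"
  have "1 \<le> k" "k \<le> n + 1 - p" using k by (auto simp: left_pivot_def)
  then have "n + 1 - k \<in> {1..n}" using pq by auto
  then have j: "j \<in> {1..n}" "n + 1 - w j = k"
    using permutes_in_image[OF permutes_inv[OF w], of "n + 1 - k"] permutes_inverses(1)[OF w]
      \<open>k \<le> n + 1 - p\<close> by (auto simp: j_def)
  have right: "right_pivot n w p q j"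
    using k unfolding right_pivot_antitranspose_iff[OF w pq j(1)] j(2) .
  have "1 \<le> i" "i \<le> q" using i by (auto simp: left_pivot_def)
  then have i_in: "i \<in> {1..n}" using pq by auto
  then have wi: "w i \<in> {1..n}" using permutes_in_image[OF w, of i] by simp
  then have wi': "n + 1 - w i \<in> {1..n}" by auto
  then have "?w (n + 1 - w i) = n + 1 - i"
    using wi permutes_inverses(2)[OF w] by (simp add: antitranspose_def)
  then have "n + 1 - ?w (n + 1 - w i) = i"
    using i_in by auto
  then have right': "right_pivot n ?w (n + 1 - q) (n + 1 - p) (n + 1 - w i)"
    using i unfolding right_pivot_antitranspose_iff[OF w' arith(4,3) wi']
      antitranspose_antitranspose[OF w] arith by simp
  interpret exchange n w p q i j
    using w E i right by unfold_locales
  interpret dual: exchange n ?w "n + 1 - q" "n + 1 - p" "n + 1 - w j" "n + 1 - w i"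
    using w' E' k right' unfolding j(2) by unfold_locales
  have dual_v: "antitranspose n v = dual.v"
    by (rule antitranspose_transpose[OF w i_in j(1)])
  have "removable n v a b" if ab: "(a, b) \<in> essential_set'' n v" for a b
  proof -
    have ab: "(a, b) \<in> essential_set'' n w" "(a, b) \<noteq> (p, q)"
      using that unfolding essential_set''_exchange by auto
    then have "a \<in> {1..n}" "b \<in> {1..n}"
      by (auto simp: essential_set''_def essential_set_def diagram_def)
    then have "(n + 1 - b, n + 1 - a) \<noteq> (n + 1 - q, n + 1 - p)"
      using ab(2) pq by auto
    then show ?thesis
      using left_removable_exchange[OF ab x] R[OF ab(1)]
        dual.left_removable_exchange[OF essential_set''_antitranspose[OF w ab(1)] _ x']
      unfolding removable_def dual_v by blast
  qed
  then show ?thesis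
    using that[OF v essential_set_exchange essential_set''_exchange rank_fun_exchange
        perm_length_exchange] by blast
qed

text \<open>The induction removes one box at a time, with \<open>removable\<close> as the invariant
  instead of the original conditions X and Z. Each removal leaves the other boxes and their ranks
  alone and adds one inversion.\<close>

lemma remove_all_boxes:
  assumes "w permutes {1..n}"
    and "\<And>a b. (a, b) \<in> essential_set'' n w \<Longrightarrow> removable n w a b"
  shows "\<exists>v. v permutes {1..n} \<and> essential_set n v = essential_set n w - essential_set'' n w \<and>
    (\<forall>(p, q) \<in> essential_set n v. rank_fun n v p q = rank_fun n w p q) \<and>
    perm_length n v = perm_length n w + card (essential_set'' n w)"
  using assms
proof (induction "card (essential_set'' n w)" arbitrary: w)
  case (0 w)
  have "finite (essential_set'' n w)"
    by (rule finite_subset[of _ "{1..n} \<times> {1..n}"])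
      (auto simp: essential_set''_def essential_set_def diagram_def)
  then have "essential_set'' n w = {}" using 0(1) by simp
  then show ?case using 0(2) by (intro exI[of _ w]) auto
next
  case (Suc m w)
  have "essential_set'' n w \<noteq> {}" using Suc.hyps(2) by auto
  then obtain p q where x: "(p, q) \<in> essential_set'' n w" by auto
  obtain u where u: "u permutes {1..n}" "essential_set n u = essential_set n w - {(p, q)}"
    "essential_set'' n u = essential_set'' n w - {(p, q)}"
    "\<And>a b. (a, b) \<in> essential_set n u \<Longrightarrow> rank_fun n u a b = rank_fun n w a b"
    "perm_length n u = perm_length n w + 1"
    "\<And>a b. (a, b) \<in> essential_set'' n u \<Longrightarrow> removable n u a b"
    using remove_box[OF Suc.prems x] by blast
  have m: "m = card (essential_set'' n u)"
    using Suc.hyps(2) x unfolding u(3) by simp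
  obtain v where v: "v permutes {1..n}" "essential_set n v = essential_set n u - essential_set'' n u"
    "\<forall>(p, q) \<in> essential_set n v. rank_fun n v p q = rank_fun n u p q"
    "perm_length n v = perm_length n u + card (essential_set'' n u)"
    using Suc.hyps(1)[OF m u(1,6)] by blast
  have "essential_set n v = essential_set n w - essential_set'' n w"
    using x unfolding v(2) u(2,3) by blast
  moreover have "rank_fun n v a b = rank_fun n w a b" if "(a, b) \<in> essential_set n v" for a b
    using bspec[OF v(3) that] u(4)[of a b] that unfolding v(2) by simp
  moreover have "perm_length n v = perm_length n w + card (essential_set'' n w)"
    using v(4) u(5) m Suc.hyps(2) by simp
  ultimately show ?case using v(1) by blast
qed

text \<open>Under B, \<open>q\<close> minus the rank is \<open>p - 1\<close>, which is therefore at
  most \<open>q\<close>. Under A the rank is zero and the first \<open>q\<close> columns have their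
  dots above row \<open>p\<close>, so \<open>q \<le> p - 1\<close>.\<close>

lemma defined_by_inclusions_if_cond_A_or_B:
  assumes w: "w permutes {1..n}"
    and AB: "\<And>p q. (p, q) \<in> essential_set n w \<Longrightarrow> cond_A n w p q \<or> cond_B n w p q"
  shows "defined_by_inclusions n w"
  unfolding defined_by_inclusions_def
proof clarify
  fix p q assume E: "(p, q) \<in> essential_set n w"
  then have pq: "1 \<le> p" "p \<le> n + 1" "1 \<le> q" "q \<le> n"
    by (auto simp: essential_set_def diagram_def)
  show "int q - int (rank_fun n w p q) = min (int p - 1) (int q)"
  proof (cases "cond_B n w p q")
    case True
    then have "q + 1 = rank_fun n w p q + p"
      using cond_B_iff_rank[OF w pq(1,2,4)] by simp
    then show ?thesis by simp
  next
    case False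
    then have A: "cond_A n w p q" using AB[OF E] by simp
    have below: "w k < p" if "k \<in> {1..q}" for k
    proof -
      have "k \<in> {1..n}" "k \<le> q" using that pq(4) by auto
      then show ?thesis using A unfolding cond_A_def not_le[symmetric] by blast
    qed
    have "1 \<le> w k" if "k \<in> {1..q}" for k
      using permutes_in_image[OF w, of k] that pq(4) by auto
    then have "w ` {1..q} \<subseteq> {1..<p}" using below by auto
    then have "card (w ` {1..q}) \<le> p - 1" using card_mono[of "{1..<p}"] by fastforce
    then have "q \<le> p - 1" by (simp add: card_image permutes_inj_on[OF w])
    then show ?thesis using A pq(1) by (simp add: cond_A_iff_rank)
  qed
qed

theorem theorem3p8:
  fixes n :: nat and w :: "nat \<Rightarrow> nat"
  assumes "w permutes {1..n}"
    and "almost_defined_by_inclusions n w"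
  shows "\<exists>v. (v permutes {1..n} \<and>
              essential_set n v = essential_set n w - essential_set'' n w \<and>
              (\<forall>(p, q) \<in> essential_set n v. rank_fun n v p q = rank_fun n w p q)) \<and>
             (\<forall>u. u permutes {1..n} \<and>
                  essential_set n u = essential_set n w - essential_set'' n w \<and>
                  (\<forall>(p, q) \<in> essential_set n u. rank_fun n u p q = rank_fun n w p q)
                  \<longrightarrow> u = v) \<and>
             defined_by_inclusions n v \<and>
             int (perm_length n v) - int (perm_length n w) = int (card (essential_set'' n w))"
proof -
  obtain v where v: "v permutes {1..n}"
      "essential_set n v = essential_set n w - essential_set'' n w"
      "\<forall>(p, q) \<in> essential_set n v. rank_fun n v p q = rank_fun n w p q"
      "perm_length n v = perm_length n w + card (essential_set'' n w)"
    using remove_all_boxes[OF assms(1) removable_if_almost_defined_by_inclusions[OF assms]] by blast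
  \<comment> \<open>Both permutations have the same essential set and, there, the ranks of
    \<open>w\<close>.\<close>
  have "u = v" if u: "u permutes {1..n}"
    "essential_set n u = essential_set n w - essential_set'' n w"
    "\<forall>(p, q) \<in> essential_set n u. rank_fun n u p q = rank_fun n w p q" for u
  proof (rule essential_data_determine_permutation[OF v(1) u(1)])
    show EQ: "essential_set n u = essential_set n v" unfolding u(2) v(2) ..
    show "rank_fun n u p q = rank_fun n v p q" if "(p, q) \<in> essential_set n v" for p q
      using that u(3) v(3) unfolding EQ by fastforce
  qed
  moreover have "defined_by_inclusions n v"
  proof (rule defined_by_inclusions_if_cond_A_or_B[OF v(1)])
    fix p q assume E: "(p, q) \<in> essential_set n v"
    then have rank: "rank_fun n v p q = rank_fun n w p q" using v(3) by blast
    have "1 \<le> p" "p \<le> n + 1" "q \<le> n" using E by (auto simp: essential_set_def diagram_def)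
    \<comment> \<open>Equal ranks transfer A and B between \<open>v\<close> and \<open>w\<close>;
      every box left over satisfies one of them for \<open>w\<close>.\<close>
    then have "cond_A n v p q \<longleftrightarrow> cond_A n w p q" "cond_B n v p q \<longleftrightarrow> cond_B n w p q"
      by (simp_all add: cond_A_iff_rank cond_B_iff_rank[OF v(1)] cond_B_iff_rank[OF assms(1)] rank)
    moreover have "cond_A n w p q \<or> cond_B n w p q"
      using E unfolding v(2) essential_set''_def by blast
    ultimately show "cond_A n v p q \<or> cond_B n v p q" by blast
  qed
  moreover have "int (perm_length n v) - int (perm_length n w) = int (card (essential_set'' n w))"
    using v(4) by simp
  ultimately show ?thesis
    using v(1-3) by blast
qed

end
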